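(* Let $y=(y_0,\dots,y_n)$ satisfy the model $$y_i=\mu_k^\star+\eta_i,\qquad t_{n,k}^\star+1\le i\le t_{n,k+1}^\star,\ 0\le k\le m,\qquad y_0=\mu_0^\star+\eta_0,$$ where $(\eta_i)_{i\in\mathbb Z}$ is the zero-mean stationary AR(1) solution of $\eta_i=\rho^\star\eta_{i-1}+\epsilon_i$, with the assumptions given in the context. Let $(\overline\rho_n)$ be a sequence of real-valued random variables with $\overline\rho_n-\rho^\star=O_P(n^{-1/2})$ as $n\to\infty$. Let $(\Delta_n)$ be a real sequence with $n^{-1}\Delta_n\to0$ and $n^{-\alpha}\Delta_n\to+\infty$ for some $\alpha>0$. Let $$\big(\widehat{\boldsymbol\delta}_n(y,\overline\rho_n),\widehat{\boldsymbol t}_n(y,\overline\rho_n)\big)=\operatorname*{arg\,min}_{(\boldsymbol\delta,\boldsymbol t)\in\mathbb{R}^{m+1}\times\mathcal{A}_{n,m}}SS_m(y,\overline\rho_n,\boldsymbol\delta,\boldsymbol t),\qquad \widehat{\boldsymbol\tau}_n(y,\overline\rho_n)=\tfrac1n\widehat{\boldsymbol t}_n(y,\overline\rho_n).$$ Then, as $n\to\infty$, $$\|\widehat{\boldsymbol\tau}_n(y,\overline\rho_n)-\boldsymbol\tau^\star\|=O_P(n^{-1}),\qquad \|\widehat{\boldsymbol\delta}_n(y,\overline\rho_n)-\boldsymbol\delta^\star\|=O_P(n^{-1/2}),$$ where $\|\cdot\|$ is the Euclidean norm. This holds when the $\epsilon_i$ are i.i.d. zero-mean Gaussian, and still holds if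 the (i.i.d.) $\epsilon_i$ are only assumed to be centered with a finite second-order moment.
   Context: Parameters. $m$ is the known true number of change-points; $0=\tau_0^\star<\tau_1^\star<\dots<\tau_{m+1}^\star=1$, $\boldsymbol\tau^\star=(\tau_k^\star)_{0\le k\le m+1}$, $t_{n,k}^\star=\lfloor n\tau_k^\star\rfloor$; $\mu_0^\star,\dots,\mu_m^\star\in\mathbb{R}$ with $\mu_k^\star\ne\mu_{k-1}^\star$ for $1\le k\le m$; $|\rho^\star|<1$; $\sigma^\star>0$; $\boldsymbol\delta^\star=(\delta_k^\star)_{0\le k\le m}$ with $\delta_k^\star=(1-\rho^\star)\mu_k^\star$. These do not depend on $n$. Noise. $(\epsilon_i)_{i\in\mathbb Z}$ are i.i.d., zero-mean with variance $\sigma^{\star2}$ (Gaussian in the Gaussian case). Admissible segmentations: $\mathcal{A}_{n,m}=\{(t_0,\dots,t_{m+1}) \text{ integers}: t_0=0<t_1<\dots<t_{m+1}=n,\ t_k-t_{k-1}\ge\Delta_n\ \forall k=1,\dots,m+1\}$. Criterion: for $x=(x_0,\dots,x_n)$, $\rho\in\mathbb{R}$, $\boldsymbol\delta=(\delta_0,\dots,\delta_m)\in\mathbb{R}^{m+1}$, $\boldsymbol t\in\mathcal A_{n,m}$, $$SS_m(x,\rho,\boldsymbol\delta,\boldsymbol t)=\sum_{k=0}^m\sum_{i=t_k+1}^{t_{k+1}}(x_i-\rho x_{i-1}-\delta_k)^2.$$ The $\arg\min$ denotes any (measurable) choice of minimizer, defined for $n$ large enough that $\mathcal A_{n,m}\neq\emptyset$.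 *)

theory Defs
  imports "HOL-Probability.Probability"
begin

text \<open>
  Finite-dimensional vectors whose length depends on the number \<open>m\<close> of change-points are
  functions on \<open>nat\<close>, of which only the indices \<open>0..m\<close> (levels) or \<open>0..m+1\<close> (segmentations)
  matter. Segment \<open>k\<close> consists of the indices \<open>t k + 1, \<dots>, t (k + 1)\<close>.
\<close>

text \<open>
  \<open>X\<^sub>n = O\<^sub>P(a\<^sub>n)\<close>. The definition is meaningful only if \<open>X n\<close> is eventually measurable,
  because \<open>measure\<close> vanishes on non-measurable sets.
\<close>

definition big_O_P :: "'a measure \<Rightarrow> (nat \<Rightarrow> 'a \<Rightarrow> real) \<Rightarrow> (nat \<Rightarrow> real) \<Rightarrow> bool" where
  "big_O_P M X a \<longleftrightarrow>
     (\<forall>\<epsilon>>0. \<exists>C>0. \<forall>\<^sub>F n in sequentially.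
        measure M {\<omega> \<in> space M. \<bar>X n \<omega>\<bar> > C * a n} \<le> \<epsilon>)"

definition iid :: "'a measure \<Rightarrow> (int \<Rightarrow> 'a \<Rightarrow> real) \<Rightarrow> bool" where
  "iid M X \<longleftrightarrow> prob_space.indep_vars M (\<lambda>_. borel) X UNIV \<and>
     (\<forall>i j. distr M borel (X i) = distr M borel (X j))"

definition gaussian_noise :: "'a measure \<Rightarrow> real \<Rightarrow> (int \<Rightarrow> 'a \<Rightarrow> real) \<Rightarrow> bool" where
  "gaussian_noise M \<sigma> X \<longleftrightarrow> iid M X \<and>
     (\<forall>i. distributed M lborel (X i) (normal_density 0 \<sigma>))"

definition centered_noise :: "'a measure \<Rightarrow> real \<Rightarrow> (int \<Rightarrow> 'a \<Rightarrow> real) \<Rightarrow> bool" where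
  "centered_noise M \<sigma> X \<longleftrightarrow> iid M X \<and>
     (\<forall>i. integrable M (\<lambda>\<omega>. (X i \<omega>)\<^sup>2) \<and>
          prob_space.expectation M (X i) = 0 \<and> prob_space.variance M (X i) = \<sigma>\<^sup>2)"

text \<open>Strict stationarity: the finite-dimensional distributions are invariant under shifts.\<close>

definition stationary :: "'a measure \<Rightarrow> (int \<Rightarrow> 'a \<Rightarrow> real) \<Rightarrow> bool" where
  "stationary M X \<longleftrightarrow> (\<forall>i. X i \<in> borel_measurable M) \<and>
     (\<forall>J h. finite J \<longrightarrow>
        distr M (\<Pi>\<^sub>M i\<in>J. borel) (\<lambda>\<omega>. \<lambda>i\<in>J. X (i + h) \<omega>) =
        distr M (\<Pi>\<^sub>M i\<in>J. borel) (\<lambda>\<omega>. \<lambda>i\<in>J. X i \<omega>))"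

text \<open>For \<open>\<bar>\<rho>\<bar> < 1\<close> this determines every \<open>\<eta> i\<close> almost surely.\<close>

definition stationary_AR1 ::
    "'a measure \<Rightarrow> real \<Rightarrow> (int \<Rightarrow> 'a \<Rightarrow> real) \<Rightarrow> (int \<Rightarrow> 'a \<Rightarrow> real) \<Rightarrow> bool" where
  "stationary_AR1 M \<rho> \<epsilon> \<eta> \<longleftrightarrow> stationary M \<eta> \<and>
     (\<forall>i. integrable M (\<eta> i) \<and> prob_space.expectation M (\<eta> i) = 0) \<and>
     (\<forall>i. AE \<omega> in M. \<eta> i \<omega> = \<rho> * \<eta> (i - 1) \<omega> + \<epsilon> i \<omega>)"

definition true_cp :: "(nat \<Rightarrow> real) \<Rightarrow> nat \<Rightarrow> nat \<Rightarrow> nat" where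
  "true_cp \<tau> n k = nat \<lfloor>real n * \<tau> k\<rfloor>"

definition segmentations :: "(nat \<Rightarrow> real) \<Rightarrow> nat \<Rightarrow> nat \<Rightarrow> (nat \<Rightarrow> nat) set" where
  "segmentations \<Delta> n m =
     {t. t 0 = 0 \<and> t (m + 1) = n \<and> (\<forall>k\<le>m. t k < t (k + 1)) \<and>
         (\<forall>k\<in>{1..m + 1}. real (t k) - real (t (k - 1)) \<ge> \<Delta> n)}"

definition SS :: "nat \<Rightarrow> (nat \<Rightarrow> real) \<Rightarrow> real \<Rightarrow> (nat \<Rightarrow> real) \<Rightarrow> (nat \<Rightarrow> nat) \<Rightarrow> real" where
  "SS m x \<rho> \<delta> t = (\<Sum>k=0..m. \<Sum>i=t k + 1..t (k + 1). (x i - \<rho> * x (i - 1) - \<delta> k)\<^sup>2)"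

end

theory Submission
  imports Defs
begin

text \<open>
  Put \<open>z\<^sub>i = y\<^sub>i - r y\<^sub>i\<^sub>-\<^sub>1\<close>, where \<open>r\<close> is the preliminary estimate of \<open>\<rho>\<close>. On the
  \<open>k\<close>-th true segment \<open>z\<^sub>i = \<beta>\<^sub>k + e\<^sub>i\<close> with the level \<open>\<beta>\<^sub>k = (1 - r) \<mu>\<^sub>k\<close> and the error
  \<open>e\<^sub>i = \<eta>\<^sub>i - r \<eta>\<^sub>i\<^sub>-\<^sub>1\<close>; only at the first point of a segment does the old level
  \<open>\<mu>\<^sub>k\<^sub>-\<^sub>1\<close> intervene, and the resulting bounded term is counted as part of \<open>e\<^sub>i\<close>. The estimators
  are therefore the least squares fit of a step function with \<open>m + 1\<close> pieces to a step function
  with \<open>m + 1\<close> pieces plus noise, and the random coefficient \<open>r\<close> does no harm, because as soon as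
  \<open>\<bar>r\<bar> \<le> 2\<close>, a sum of errors is bounded by the sum of the same values of \<open>\<eta>\<close>, twice the sum of
  the preceding values, both in absolute value, and a constant.

  For the fit, three bounds on sums of errors are enough.

  First, suppose that the square of the sum over any window \<open>{a<..b}\<close> is at most
  \<open>\<zeta> n (b - a)\<close>. Comparing the fit with the true step function and using the
  elementary inequality \<open>2 x S \<le> L x\<^sup>2 / 2 + 2 S\<^sup>2 / L\<close> on each of the at most \<open>(m + 1)\<^sup>2\<close>
  overlaps of a true and a fitted segment shows that the sum of the squared differences of the two
  step functions is at most \<open>4 (m + 1)\<^sup>2 \<zeta> n\<close> (lemma \<open>fit_error_le\<close>). For small \<open>\<zeta>\<close>
  no fitted segment can cover a large neighbourhood of a true change, so each true change has a
  fitted change nearby. As there are equally many, the \<open>k\<close>-th is close to the \<open>k\<close>-th, at a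
  distance that is a small multiple of \<open>n\<close>, and the fitted levels are close to the true ones
  (\<open>fitted_changes_consistent\<close>, \<open>fitted_levels_consistent\<close>).

  Second, suppose that the sums over windows of length \<open>L \<ge> C\<close> that start or end at a true change
  are below a small multiple of \<open>L\<close>. If a single fitted change is moved to the true
  position and the fitted levels are kept, then the residual sum of squares changes only on the
  window between the two positions, where a wrong level is replaced by a nearly right one.
  By optimality this is no gain, which forces a large sum of errors on the window; so its length
  is at most \<open>C\<close> (\<open>fitted_change_rate\<close>). This is the rate \<open>1 / n\<close> for \<open>\<tau>\<close>.

  Third, a fitted level is the mean of \<open>z\<close> over a segment that agrees with the true one up to
  \<open>C\<close> points at either end, so that its error is of the order of a sum of errors divided by \<open>n\<close>
  (\<open>fitted_level_error_le\<close>). There are only boundedly many such segments, and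
  Chebyshev's inequality gives the rate \<open>1 / \<surd>n\<close>.

  The three bounds hold with high probability because of a single second-order property: the
  second moment of a sum of \<open>L\<close> consecutive values of \<open>\<eta>\<close> is at most \<open>V L\<close>
  (\<open>AR1_block_sum\<close>). It implies that all sums of length at least \<open>N\<close> from a given point stay below a
  line of given slope, if \<open>N\<close> is large (\<open>rare_partial_sum_above_line\<close>). For the
  bound over all windows, this settles the long ones, and the short ones follow from the
  Cauchy-Schwarz inequality and truncation, since the \<open>\<eta>\<^sub>i\<^sup>2\<close> are identically distributed and integrable
  (\<open>rare_large_window\<close>). Gaussian noise is the special case \<open>gaussian_imp_centered_noise\<close>.
\<close>

section \<open>Events of small outer probability\<close>

text \<open>
  Outer probability at most \<open>p\<close>. Error events are unions over windows and estimated quantities;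
  covering them by measurable sets avoids a measurability proof for each of them.
\<close>

definition rare :: "'a measure \<Rightarrow> real \<Rightarrow> 'a set \<Rightarrow> bool" where
  "rare M p A \<longleftrightarrow> (\<exists>B\<in>sets M. A \<subseteq> B \<and> measure M B \<le> p)"

lemma rare_mono: "rare M p A \<Longrightarrow> A' \<subseteq> A \<Longrightarrow> p \<le> q \<Longrightarrow> rare M q A'"
  unfolding rare_def by (meson order_trans)

lemma rare_empty: "0 \<le> p \<Longrightarrow> rare M p {}"
  unfolding rare_def by (rule bexI[of _ "{}"]) auto

context prob_space
begin

text \<open>
  Also true for a non-measurable \<open>A\<close>, whose \<open>measure\<close> is \<open>0\<close> by convention.
\<close>

lemma measure_le_of_rare:
  assumes "rare M p A" shows "measure M A \<le> p"
proof -
  obtain B where B: "B \<in> sets M" "A \<subseteq> B" "measure M B \<le> p"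
    using assms by (auto simp: rare_def)
  show ?thesis
  proof (cases "A \<in> sets M")
    case True
    then show ?thesis using B finite_measure_mono[of A B] by linarith
  next
    case False
    then show ?thesis
      using B order_trans[OF measure_nonneg[of M B], of p] by (simp add: measure_notin_sets)
  qed
qed

lemma rare_Un:
  assumes "rare M p A" "rare M q B" shows "rare M (p + q) (A \<union> B)"
proof -
  obtain A' where A': "A' \<in> sets M" "A \<subseteq> A'" "measure M A' \<le> p"
    using assms(1) by (auto simp: rare_def)
  obtain B' where B': "B' \<in> sets M" "B \<subseteq> B'" "measure M B' \<le> q"
    using assms(2) by (auto simp: rare_def)
  have "measure M (A' \<union> B') \<le> p + q"
    using measure_Un_le[of A' M B'] A' B' by linarith
  then show ?thesis
    unfolding rare_def using A' B' by (intro bexI[of _ "A' \<union> B'"]) auto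
qed

lemma rare_UN_finite:
  assumes "finite I" "\<And>i. i \<in> I \<Longrightarrow> rare M (p i) (A i)"
  shows "rare M (\<Sum>i\<in>I. p i) (\<Union>i\<in>I. A i)"
  using assms
proof (induction I rule: finite_induct)
  case empty
  then show ?case by (simp add: rare_empty)
next
  case (insert i I)
  then show ?case using rare_Un[of "p i" "A i" "sum p I" "\<Union> (A ` I)"] by simp
qed

lemma rare_UN_nat:
  fixes A :: "nat \<Rightarrow> 'a set"
  assumes "\<And>j. rare M (p j) (A j)" "summable p"
  shows "rare M (suminf p) (\<Union>j. A j)"
proof -
  obtain B where B: "\<And>j. B j \<in> sets M" "\<And>j. A j \<subseteq> B j" "\<And>j. measure M (B j) \<le> p j"
    using assms(1) unfolding rare_def by metis
  have sm: "summable (\<lambda>j. measure M (B j))"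
    by (rule summable_comparison_test'[OF assms(2), of 0]) (use B in auto)
  have "measure M (\<Union>j. B j) \<le> (\<Sum>j. measure M (B j))"
    using B sm by (intro finite_measure_subadditive_countably) auto
  also have "\<dots> \<le> suminf p"
    using B sm assms(2) by (intro suminf_le) auto
  finally show ?thesis
    unfolding rare_def using B by (intro bexI[of _ "\<Union>j. B j"]) auto
qed

lemma rare_Markov:
  assumes "integrable M X" "\<And>\<omega>. \<omega> \<in> space M \<Longrightarrow> 0 \<le> X \<omega>" "expectation X \<le> v" "c > 0"
  shows "rare M (v / c) {\<omega>\<in>space M. X \<omega> \<ge> c}"
proof -
  have [measurable]: "X \<in> borel_measurable M" using assms by auto
  have "measure M {\<omega>\<in>space M. X \<omega> \<ge> c} \<le> expectation X / c"
    using assms by (intro integral_Markov_inequality_measure[where A="space M"]) auto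
  also have "\<dots> \<le> v / c" using assms by (simp add: divide_right_mono)
  finally show ?thesis
    unfolding rare_def by (intro bexI[of _ "{\<omega>\<in>space M. X \<omega> \<ge> c}"]) auto
qed

lemma rare_Chebyshev:
  assumes "integrable M (\<lambda>\<omega>. (X \<omega>)\<^sup>2)" "expectation (\<lambda>\<omega>. (X \<omega>)\<^sup>2) \<le> v" "c > 0"
  shows "rare M (v / c\<^sup>2) {\<omega>\<in>space M. \<bar>X \<omega>\<bar> \<ge> c}"
proof -
  have "rare M (v / c\<^sup>2) {\<omega>\<in>space M. (X \<omega>)\<^sup>2 \<ge> c\<^sup>2}"
    using assms by (intro rare_Markov) auto
  moreover have "\<bar>x\<bar> \<ge> c \<longleftrightarrow> x\<^sup>2 \<ge> c\<^sup>2" for x :: real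
    using assms(3) by (metis abs_le_square_iff abs_of_pos)
  ultimately show ?thesis by simp
qed

end

section \<open>Second moments of the stationary AR(1) process\<close>

context prob_space
begin

lemma gaussian_imp_centered_noise:
  assumes "gaussian_noise M \<sigma> X" "\<sigma> > 0" shows "centered_noise M \<sigma> X"
proof -
  have D: "distributed M lborel (X i) (normal_density 0 \<sigma>)" for i
    using assms by (simp add: gaussian_noise_def)
  have "integrable M (\<lambda>\<omega>. (X i \<omega>)\<^sup>2)" for i
    using distributed_integrable[OF D[of i], of "\<lambda>x. x\<^sup>2"]
      integrable_normal_moment[OF assms(2), of 0 2] by simp
  moreover have "expectation (X i) = 0" for i
    by (rule normal_distributed_expectation[OF assms(2) D])
  moreover have "variance (X i) = \<sigma>\<^sup>2" for i
    by (rule normal_distributed_variance[OF assms(2) D])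
  ultimately show ?thesis using assms(1)
    by (simp add: gaussian_noise_def centered_noise_def)
qed

text \<open>
  Independent centered variables are orthogonal, so only the diagonal terms of the squared sum
  survive.
\<close>

lemma noise_second_moment:
  assumes "centered_noise M \<sigma> \<epsilon>" "finite I"
  shows "integrable M (\<lambda>\<omega>. (\<Sum>i\<in>I. a i * \<epsilon> i \<omega>)\<^sup>2)"
    and "expectation (\<lambda>\<omega>. (\<Sum>i\<in>I. a i * \<epsilon> i \<omega>)\<^sup>2) = \<sigma>\<^sup>2 * (\<Sum>i\<in>I. (a i)\<^sup>2)"
proof -
  have indep: "indep_vars (\<lambda>_. borel) \<epsilon> UNIV"
    and sq: "integrable M (\<lambda>\<omega>. (\<epsilon> i \<omega>)\<^sup>2)" and mean: "expectation (\<epsilon> i) = 0"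
    for i
    using assms(1) by (auto simp: centered_noise_def iid_def)
  have var: "expectation (\<lambda>\<omega>. (\<epsilon> i \<omega>)\<^sup>2) = \<sigma>\<^sup>2" for i
    using assms(1) mean[of i] unfolding centered_noise_def by (metis (no_types, lifting) Bochner_Integration.integral_cong diff_zero)
  have [measurable]: "\<epsilon> i \<in> borel_measurable M" for i
    using indep by (auto simp: indep_vars_def)
  have int: "integrable M (\<epsilon> i)" for i
    by (rule square_integrable_imp_integrable[OF _ sq]) auto
  have prod: "integrable M (\<lambda>\<omega>. \<epsilon> i \<omega> * \<epsilon> j \<omega>)"
    "expectation (\<lambda>\<omega>. \<epsilon> i \<omega> * \<epsilon> j \<omega>) = (if i = j then \<sigma>\<^sup>2 else 0)" for i j
  proof -
    have "integrable M (\<lambda>\<omega>. \<epsilon> i \<omega> * \<epsilon> j \<omega>) \<and>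
          expectation (\<lambda>\<omega>. \<epsilon> i \<omega> * \<epsilon> j \<omega>) = (if i = j then \<sigma>\<^sup>2 else 0)"
    proof (cases "i = j")
      case True
      then show ?thesis using sq[of i] var[of i] mean[of i] by (simp add: power2_eq_square)
    next
      case False
      have "integrable M (\<lambda>\<omega>. \<Prod>k\<in>{i,j}. \<epsilon> k \<omega>)"
        "expectation (\<lambda>\<omega>. \<Prod>k\<in>{i,j}. \<epsilon> k \<omega>) = (\<Prod>k\<in>{i,j}. expectation (\<epsilon> k))"
        using indep_vars_integrable[of "{i,j}" \<epsilon>] indep_vars_lebesgue_integral[of "{i,j}" \<epsilon>]
          indep_vars_subset[OF indep, of "{i,j}"] int by auto
      then show ?thesis using False mean by simp
    qed
    then show "integrable M (\<lambda>\<omega>. \<epsilon> i \<omega> * \<epsilon> j \<omega>)"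
      "expectation (\<lambda>\<omega>. \<epsilon> i \<omega> * \<epsilon> j \<omega>) = (if i = j then \<sigma>\<^sup>2 else 0)" by auto
  qed
  have eq: "(\<Sum>i\<in>I. a i * \<epsilon> i \<omega>)\<^sup>2 = (\<Sum>i\<in>I. \<Sum>j\<in>I. (a i * a j) * (\<epsilon> i \<omega> * \<epsilon> j \<omega>))" for \<omega>
    by (simp add: power2_eq_square sum_product algebra_simps)
  show "integrable M (\<lambda>\<omega>. (\<Sum>i\<in>I. a i * \<epsilon> i \<omega>)\<^sup>2)"
    unfolding eq by (intro Bochner_Integration.integrable_sum integrable_mult_right prod)
  have "expectation (\<lambda>\<omega>. (\<Sum>i\<in>I. a i * \<epsilon> i \<omega>)\<^sup>2)
      = (\<Sum>i\<in>I. \<Sum>j\<in>I. (a i * a j) * (if i = j then \<sigma>\<^sup>2 else 0))"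
    unfolding eq by (simp add: Bochner_Integration.integral_sum prod)
  also have "\<dots> = (\<Sum>i\<in>I. (a i)\<^sup>2 * \<sigma>\<^sup>2)"
  proof (rule sum.cong[OF refl])
    fix i assume "i \<in> I"
    have "(\<Sum>j\<in>I. (a i * a j) * (if i = j then \<sigma>\<^sup>2 else 0))
        = (\<Sum>j\<in>I. if i = j then a i * a j * \<sigma>\<^sup>2 else 0)"
      by (intro sum.cong) auto
    also have "\<dots> = (a i)\<^sup>2 * \<sigma>\<^sup>2"
      using \<open>i \<in> I\<close> assms(2) by (simp add: power2_eq_square)
    finally show "(\<Sum>j\<in>I. (a i * a j) * (if i = j then \<sigma>\<^sup>2 else 0)) = (a i)\<^sup>2 * \<sigma>\<^sup>2" .
  qed
  finally show "expectation (\<lambda>\<omega>. (\<Sum>i\<in>I. a i * \<epsilon> i \<omega>)\<^sup>2) = \<sigma>\<^sup>2 * (\<Sum>i\<in>I. (a i)\<^sup>2)"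
    by (simp add: sum_distrib_left mult.commute)
qed

text \<open>
  Stationarity for the one-element index set \<open>{0}\<close>.
\<close>

lemma stationary_distr:
  assumes "stationary M \<eta>" shows "distr M borel (\<eta> i) = distr M borel (\<eta> 0)"
proof -
  have [measurable]: "\<eta> j \<in> borel_measurable M" for j
    using assms by (auto simp: stationary_def)
  have d: "distr M borel (\<eta> (0 + h)) =
      distr (distr M (\<Pi>\<^sub>M i\<in>{0}. borel) (\<lambda>\<omega>. \<lambda>i\<in>{0}. \<eta> (i + h) \<omega>)) borel (\<lambda>x. x 0)" for h
    by (subst distr_distr) (auto simp: comp_def)
  have e: "distr M (\<Pi>\<^sub>M i\<in>{0}. borel) (\<lambda>\<omega>. \<lambda>i\<in>{0}. \<eta> (i + h) \<omega>)
      = distr M (\<Pi>\<^sub>M i\<in>{0}. borel) (\<lambda>\<omega>. \<lambda>i\<in>{0}. \<eta> i \<omega>)" for h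
    using assms unfolding stationary_def by blast
  have "distr M borel (\<eta> (0 + i)) = distr M borel (\<eta> (0 + 0))"
    unfolding d e ..
  then show ?thesis by simp
qed

end

lemma geometric_sum_squares_le:
  fixes \<rho> :: real
  assumes "\<bar>\<rho>\<bar> < 1" shows "(\<Sum>q<p. (\<rho> ^ q)\<^sup>2) \<le> 1 / (1 - \<rho>\<^sup>2)"
proof -
  have l: "\<rho>\<^sup>2 < 1" using assms by (simp add: abs_square_less_1)
  have "(\<Sum>q<p. (\<rho> ^ q)\<^sup>2) = (\<Sum>q<p. (\<rho>\<^sup>2) ^ q)"
    by (simp add: power_mult[symmetric] mult.commute)
  also have "\<dots> = (1 - (\<rho>\<^sup>2) ^ p) / (1 - \<rho>\<^sup>2)"
    using l by (simp add: sum_gp_strict)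
  also have "\<dots> \<le> 1 / (1 - \<rho>\<^sup>2)"
    using l by (intro divide_right_mono) auto
  finally show ?thesis .
qed

context prob_space
begin

lemma stationary_expectation:
  fixes f :: "real \<Rightarrow> real"
  assumes "stationary M \<eta>" "f \<in> borel_measurable borel"
  shows "expectation (\<lambda>\<omega>. f (\<eta> i \<omega>)) = expectation (\<lambda>\<omega>. f (\<eta> 0 \<omega>))"
proof -
  have [measurable]: "\<eta> j \<in> borel_measurable M" for j
    using assms by (auto simp: stationary_def)
  have "expectation (\<lambda>\<omega>. f (\<eta> j \<omega>)) = integral\<^sup>L (distr M borel (\<eta> j)) f" for j
    using assms(2) by (simp add: integral_distr)
  then show ?thesis by (simp add: stationary_distr[OF assms(1), of i])
qed

lemma AR1_unroll:
  assumes "stationary_AR1 M \<rho> \<epsilon> \<eta>"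
  shows "AE \<omega> in M. \<eta> i \<omega> = \<rho> ^ p * \<eta> (i - int p) \<omega> + (\<Sum>q<p. \<rho> ^ q * \<epsilon> (i - int q) \<omega>)"
proof (induction p)
  case 0
  then show ?case by simp
next
  case (Suc p)
  have "AE \<omega> in M. \<eta> (i - int p) \<omega> = \<rho> * \<eta> (i - int p - 1) \<omega> + \<epsilon> (i - int p) \<omega>"
    using assms by (auto simp: stationary_AR1_def)
  with Suc show ?case
  proof eventually_elim
    case (elim \<omega>)
    have "i - int p - 1 = i - int (Suc p)" by simp
    then show ?case using elim by (simp add: algebra_simps)
  qed
qed

text \<open>
  Square integrability of \<open>\<eta>\<close> is not part of the definition of the process, only integrability.
  It is inherited from the noise: the remainder \<open>\<rho>\<^sup>p \<eta>\<^sub>i\<^sub>-\<^sub>p\<close> of the unrolled recursion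
  tends to \<open>0\<close> in \<open>L\<^sup>1\<close> by stationarity, hence almost surely along a subsequence; the
  weighted partial sums of the noise have second moments at most \<open>\<sigma>\<^sup>2 / (1 - \<rho>\<^sup>2)\<close>, and Fatou's
  lemma transfers this bound to their limit \<open>\<eta>\<^sub>i\<close>.
\<close>

lemma AR1_second_moment:
  assumes noise: "centered_noise M \<sigma> \<epsilon>" and ar: "stationary_AR1 M \<rho> \<epsilon> \<eta>" and r: "\<bar>\<rho>\<bar> < 1"
  shows "integrable M (\<lambda>\<omega>. (\<eta> i \<omega>)\<^sup>2)"
    and "expectation (\<lambda>\<omega>. (\<eta> i \<omega>)\<^sup>2) \<le> \<sigma>\<^sup>2 / (1 - \<rho>\<^sup>2)"
proof -
  have st: "stationary M \<eta>" and int: "\<And>i. integrable M (\<eta> i)"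
    using ar by (auto simp: stationary_AR1_def)
  have [measurable]: "\<eta> j \<in> borel_measurable M" for j
    using st by (auto simp: stationary_def)
  have [measurable]: "\<epsilon> j \<in> borel_measurable M" for j
    using noise by (auto simp: centered_noise_def iid_def indep_vars_def)
  define v where "v = \<sigma>\<^sup>2 / (1 - \<rho>\<^sup>2)"
  have v0: "v \<ge> 0" using r by (simp add: v_def abs_square_le_1)
  define U where "U p \<omega> = (\<Sum>q<p. \<rho> ^ q * \<epsilon> (i - int q) \<omega>)" for p \<omega>
  define R where "R p \<omega> = \<rho> ^ p * \<eta> (i - int p) \<omega>" for p \<omega>
  have [measurable]: "U p \<in> borel_measurable M" for p by (simp add: U_def[abs_def])
  have EU: "integrable M (\<lambda>\<omega>. (U p \<omega>)\<^sup>2)" "expectation (\<lambda>\<omega>. (U p \<omega>)\<^sup>2) \<le> v" for p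
  proof -
    have c: "finite ((\<lambda>q. i - int q) ` {..<p})" by simp
    have inj: "inj_on (\<lambda>q. i - int q) {..<p}" by (auto simp: inj_on_def)
    have eq: "U p \<omega> = (\<Sum>j\<in>(\<lambda>q. i - int q) ` {..<p}. \<rho> ^ nat (i - j) * \<epsilon> j \<omega>)" for \<omega>
      by (simp add: sum.reindex[OF inj] U_def)
    show "integrable M (\<lambda>\<omega>. (U p \<omega>)\<^sup>2)"
      unfolding eq by (rule noise_second_moment(1)[OF noise c])
    have "expectation (\<lambda>\<omega>. (U p \<omega>)\<^sup>2) = \<sigma>\<^sup>2 * (\<Sum>q<p. (\<rho> ^ q)\<^sup>2)"
      unfolding eq noise_second_moment(2)[OF noise c] by (simp add: sum.reindex[OF inj])
    also have "\<dots> \<le> \<sigma>\<^sup>2 * (1 / (1 - \<rho>\<^sup>2))"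
      by (intro mult_left_mono geometric_sum_squares_le r) auto
    finally show "expectation (\<lambda>\<omega>. (U p \<omega>)\<^sup>2) \<le> v" by (simp add: v_def)
  qed
  have "(\<lambda>p. \<integral>\<omega>. norm (R p \<omega>) \<partial>M) \<longlonglongrightarrow> 0"
  proof -
    have "(\<integral>\<omega>. norm (R p \<omega>) \<partial>M) = \<bar>\<rho>\<bar> ^ p * expectation (\<lambda>\<omega>. \<bar>\<eta> 0 \<omega>\<bar>)" for p
      using stationary_expectation[OF st, of abs "i - int p"]
      by (simp add: R_def abs_mult power_abs)
    moreover have "(\<lambda>p. \<bar>\<rho>\<bar> ^ p * expectation (\<lambda>\<omega>. \<bar>\<eta> 0 \<omega>\<bar>)) \<longlonglongrightarrow> 0 * expectation (\<lambda>\<omega>. \<bar>\<eta> 0 \<omega>\<bar>)"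
      using r by (intro tendsto_mult LIMSEQ_power_zero tendsto_const) auto
    ultimately show ?thesis by simp
  qed
  moreover have "integrable M (R p)" for p using int by (simp add: R_def[abs_def])
  ultimately obtain s where s: "strict_mono s" "AE \<omega> in M. (\<lambda>p. R (s p) \<omega>) \<longlonglongrightarrow> 0"
    using tendsto_L1_AE_subseq[of M R] by blast
  have "AE \<omega> in M. \<forall>p. \<eta> i \<omega> = R p \<omega> + U p \<omega>"
    unfolding AE_all_countable R_def U_def using AR1_unroll[OF ar] by blast
  with s(2) have "AE \<omega> in M. ennreal ((\<eta> i \<omega>)\<^sup>2) = liminf (\<lambda>p. ennreal ((U (s p) \<omega>)\<^sup>2))"
  proof eventually_elim
    case (elim \<omega>)
    have "(\<lambda>p. \<eta> i \<omega> - R (s p) \<omega>) \<longlonglongrightarrow> \<eta> i \<omega> - 0"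
      by (intro tendsto_intros elim)
    moreover have "\<eta> i \<omega> - R (s p) \<omega> = U (s p) \<omega>" for p using elim(2)[rule_format, of "s p"] by simp
    ultimately have "(\<lambda>p. U (s p) \<omega>) \<longlonglongrightarrow> \<eta> i \<omega>" by simp
    then have "(\<lambda>p. ennreal ((U (s p) \<omega>)\<^sup>2)) \<longlonglongrightarrow> ennreal ((\<eta> i \<omega>)\<^sup>2)"
      by (intro tendsto_ennrealI tendsto_power)
    then show ?case by (intro lim_imp_Liminf[symmetric]) auto
  qed
  then have "(\<integral>\<^sup>+\<omega>. ennreal ((\<eta> i \<omega>)\<^sup>2) \<partial>M) = (\<integral>\<^sup>+\<omega>. liminf (\<lambda>p. ennreal ((U (s p) \<omega>)\<^sup>2)) \<partial>M)"
    by (rule nn_integral_cong_AE)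
  also have "\<dots> \<le> liminf (\<lambda>p. \<integral>\<^sup>+\<omega>. ennreal ((U (s p) \<omega>)\<^sup>2) \<partial>M)"
    by (rule nn_integral_liminf) auto
  also have "\<dots> \<le> ennreal v"
  proof -
    have "(\<integral>\<^sup>+\<omega>. ennreal ((U (s p) \<omega>)\<^sup>2) \<partial>M) \<le> ennreal v" for p
      using EU[of "s p"] by (subst nn_integral_eq_integral) (auto intro: ennreal_leI)
    then have "liminf (\<lambda>p. \<integral>\<^sup>+\<omega>. ennreal ((U (s p) \<omega>)\<^sup>2) \<partial>M) \<le> liminf (\<lambda>p. ennreal v)"
      by (intro Liminf_mono) auto
    then show ?thesis by (simp add: Liminf_const)
  qed
  finally have le: "(\<integral>\<^sup>+\<omega>. ennreal ((\<eta> i \<omega>)\<^sup>2) \<partial>M) \<le> ennreal v" .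
  show sq: "integrable M (\<lambda>\<omega>. (\<eta> i \<omega>)\<^sup>2)"
    by (rule integrableI_bounded) (use le in \<open>auto simp: le_less_trans\<close>)
  show "expectation (\<lambda>\<omega>. (\<eta> i \<omega>)\<^sup>2) \<le> \<sigma>\<^sup>2 / (1 - \<rho>\<^sup>2)"
    using le v0 sq unfolding v_def[symmetric] by (subst (asm) nn_integral_eq_integral) auto
qed

end

lemma telescoping_shift:
  fixes f :: "int \<Rightarrow> real"
  shows "(\<Sum>j<L. f (h + int j - 1)) = (\<Sum>j<L. f (h + int j)) + f (h - 1) - f (h + int L - 1)"
  by (induction L) (auto simp: algebra_simps)

lemma square_sum_two: "((x::real) + y)\<^sup>2 \<le> 2 * x\<^sup>2 + 2 * y\<^sup>2"
  using zero_le_power2[of "x - y"] by (simp add: power2_eq_square algebra_simps)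

context prob_space
begin

text \<open>
  Summing the recursion over a block gives
  \<open>(1 - \<rho>) \<Sum> \<eta>\<^sub>j = \<Sum> \<epsilon>\<^sub>j + \<rho> (\<eta>\<^sub>h\<^sub>-\<^sub>1 - \<eta>\<^sub>h\<^sub>+\<^sub>L\<^sub>-\<^sub>1)\<close>. The first sum has variance
  \<open>\<sigma>\<^sup>2 L\<close>, and the boundary terms are bounded in \<open>L\<^sup>2\<close>; so the correlations of \<open>\<eta>\<close> do
  not affect the order of growth.
\<close>

lemma AR1_block_sum:
  assumes noise: "centered_noise M \<sigma> \<epsilon>" and ar: "stationary_AR1 M \<rho> \<epsilon> \<eta>" and r: "\<bar>\<rho>\<bar> < 1"
  obtains V where "V > 0"
    "\<And>h L. integrable M (\<lambda>\<omega>. (\<Sum>j<L. \<eta> (h + int j) \<omega>)\<^sup>2)"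
    "\<And>h L. expectation (\<lambda>\<omega>. (\<Sum>j<L. \<eta> (h + int j) \<omega>)\<^sup>2) \<le> V * real L"
proof -
  define v where "v = \<sigma>\<^sup>2 / (1 - \<rho>\<^sup>2)"
  define V where "V = (2 * \<sigma>\<^sup>2 + 8 * v) / (1 - \<rho>)\<^sup>2"
  have st: "stationary M \<eta>" using ar by (auto simp: stationary_AR1_def)
  have [measurable]: "\<eta> j \<in> borel_measurable M" for j
    using st by (auto simp: stationary_def)
  note E\<eta> = AR1_second_moment[OF noise ar r, folded v_def]
  have v0: "v \<ge> 0" using r by (simp add: v_def abs_square_le_1)
  have \<rho>1: "(1 - \<rho>)\<^sup>2 > 0" "\<rho>\<^sup>2 \<le> 1" using r by (auto simp: abs_square_le_1)
  have V0: "V \<ge> 0" using v0 by (simp add: V_def)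
  define S where "S h L \<omega> = (\<Sum>j<L. \<eta> (h + int j) \<omega>)" for h L \<omega>
  define N where "N h L \<omega> = (\<Sum>j<L. \<epsilon> (h + int j) \<omega>)" for h L \<omega>
  define D where "D h L \<omega> = (2 * (N h L \<omega>)\<^sup>2 + 4 * ((\<eta> (h - 1) \<omega>)\<^sup>2 + (\<eta> (h + int L - 1) \<omega>)\<^sup>2)) / (1 - \<rho>)\<^sup>2"
    for h L \<omega>
  have [measurable]: "S h L \<in> borel_measurable M" for h L by (simp add: S_def[abs_def])
  have N: "integrable M (\<lambda>\<omega>. (N h L \<omega>)\<^sup>2)" "expectation (\<lambda>\<omega>. (N h L \<omega>)\<^sup>2) = \<sigma>\<^sup>2 * real L" for h L
  proof -
    have c: "finite ((\<lambda>j. h + int j) ` {..<L})" by simp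
    have inj: "inj_on (\<lambda>j. h + int j) {..<L}" by (auto simp: inj_on_def)
    have eq: "N h L \<omega> = (\<Sum>j\<in>(\<lambda>j. h + int j) ` {..<L}. 1 * \<epsilon> j \<omega>)" for \<omega>
      by (simp add: sum.reindex[OF inj] N_def)
    show "integrable M (\<lambda>\<omega>. (N h L \<omega>)\<^sup>2)"
      unfolding eq by (rule noise_second_moment(1)[OF noise c])
    show "expectation (\<lambda>\<omega>. (N h L \<omega>)\<^sup>2) = \<sigma>\<^sup>2 * real L"
      unfolding eq noise_second_moment(2)[OF noise c] by (simp add: card_image[OF inj])
  qed
  have D: "integrable M (D h L)" for h L
    unfolding D_def[abs_def] using N E\<eta> by auto
  have ED: "expectation (D h L) \<le> V * real L" if "L > 0" for h L
  proof -
    have "expectation (D h L) = (2 * (\<sigma>\<^sup>2 * real L) +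
        4 * (expectation (\<lambda>\<omega>. (\<eta> (h - 1) \<omega>)\<^sup>2) + expectation (\<lambda>\<omega>. (\<eta> (h + int L - 1) \<omega>)\<^sup>2))) / (1 - \<rho>)\<^sup>2"
      unfolding D_def[abs_def] using N E\<eta> by simp
    also have "\<dots> \<le> (2 * (\<sigma>\<^sup>2 * real L) + 4 * (v + v)) / (1 - \<rho>)\<^sup>2"
      by (intro divide_right_mono add_left_mono mult_left_mono add_mono E\<eta>) auto
    also have "\<dots> \<le> (2 * (\<sigma>\<^sup>2 * real L) + 8 * v * real L) / (1 - \<rho>)\<^sup>2"
      using that v0 mult_left_mono[of 1 "real L" v] by (intro divide_right_mono add_left_mono) auto
    also have "\<dots> = V * real L" by (simp add: V_def algebra_simps)
    finally show ?thesis .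
  qed
  have SD: "AE \<omega> in M. (S h L \<omega>)\<^sup>2 \<le> D h L \<omega>" for h L
  proof -
    have "AE \<omega> in M. \<forall>j. \<eta> j \<omega> = \<rho> * \<eta> (j - 1) \<omega> + \<epsilon> j \<omega>"
      unfolding AE_all_countable using ar by (auto simp: stationary_AR1_def)
    then show ?thesis
    proof eventually_elim
      case (elim \<omega>)
      have "S h L \<omega> = (\<Sum>j<L. \<rho> * \<eta> (h + int j - 1) \<omega> + \<epsilon> (h + int j) \<omega>)"
        unfolding S_def by (rule sum.cong[OF refl], rule elim[rule_format])
      also have "\<dots> = \<rho> * (S h L \<omega> + \<eta> (h - 1) \<omega> - \<eta> (h + int L - 1) \<omega>) + N h L \<omega>"
        using telescoping_shift[of "\<lambda>j. \<eta> j \<omega>" h L]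
        by (simp add: sum.distrib sum_distrib_left[symmetric] S_def N_def)
      finally have eq: "(1 - \<rho>) * S h L \<omega> = N h L \<omega> + \<rho> * (\<eta> (h - 1) \<omega> - \<eta> (h + int L - 1) \<omega>)"
        by algebra
      have "(\<rho> * (\<eta> (h - 1) \<omega> - \<eta> (h + int L - 1) \<omega>))\<^sup>2
          \<le> 1 * (\<eta> (h - 1) \<omega> + - \<eta> (h + int L - 1) \<omega>)\<^sup>2"
        unfolding power_mult_distrib using \<rho>1 by (intro mult_mono) auto
      also have "\<dots> \<le> 2 * ((\<eta> (h - 1) \<omega>)\<^sup>2 + (\<eta> (h + int L - 1) \<omega>)\<^sup>2)"
        using square_sum_two[of "\<eta> (h - 1) \<omega>" "- \<eta> (h + int L - 1) \<omega>"] by simp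
      finally have "((1 - \<rho>) * S h L \<omega>)\<^sup>2
          \<le> 2 * (N h L \<omega>)\<^sup>2 + 4 * ((\<eta> (h - 1) \<omega>)\<^sup>2 + (\<eta> (h + int L - 1) \<omega>)\<^sup>2)"
        unfolding eq using square_sum_two[of "N h L \<omega>" "\<rho> * (\<eta> (h - 1) \<omega> - \<eta> (h + int L - 1) \<omega>)"]
        by linarith
      then show ?case using \<rho>1 by (simp add: D_def power_mult_distrib pos_le_divide_eq mult.commute)
    qed
  qed
  have int: "integrable M (\<lambda>\<omega>. (S h L \<omega>)\<^sup>2)" for h L
  proof (rule Bochner_Integration.integrable_bound[OF D[of h L]])
    show "AE \<omega> in M. norm ((S h L \<omega>)\<^sup>2) \<le> norm (D h L \<omega>)"
      using SD[of h L] by eventually_elim auto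
  qed auto
  have le: "expectation (\<lambda>\<omega>. (S h L \<omega>)\<^sup>2) \<le> V * real L" for h L
  proof (cases "L = 0")
    case True
    then show ?thesis by (simp add: S_def)
  next
    case False
    have "expectation (\<lambda>\<omega>. (S h L \<omega>)\<^sup>2) \<le> expectation (D h L)"
      by (intro integral_mono_AE int D SD)
    then show ?thesis using ED[of L h] False by simp
  qed
  show thesis
  proof (rule that[of "V + 1"])
    show "V + 1 > 0" using V0 by simp
    show "integrable M (\<lambda>\<omega>. (\<Sum>j<L. \<eta> (h + int j) \<omega>)\<^sup>2)" for h L
      using int by (simp add: S_def)
    show "expectation (\<lambda>\<omega>. (\<Sum>j<L. \<eta> (h + int j) \<omega>)\<^sup>2) \<le> (V + 1) * real L" for h L
      using le[of h L] by (simp add: S_def algebra_simps)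
  qed
qed

end

section \<open>Maximal inequalities from second moments\<close>

text \<open>
  The growth condition shared by \<open>\<eta>\<close> read forwards and backwards from any point. It is invariant
  under shifts and, for \<open>L = 1\<close>, bounds the single second moments.
\<close>

definition linear_second_moments :: "'a measure \<Rightarrow> real \<Rightarrow> (nat \<Rightarrow> 'a \<Rightarrow> real) \<Rightarrow> bool" where
  "linear_second_moments M V X \<longleftrightarrow> (\<forall>a L. integrable M (\<lambda>\<omega>. (\<Sum>i<L. X (a + i) \<omega>)\<^sup>2) \<and>
     integral\<^sup>L M (\<lambda>\<omega>. (\<Sum>i<L. X (a + i) \<omega>)\<^sup>2) \<le> V * real L)"

lemma between_squares: "\<exists>j::nat. j\<^sup>2 \<le> k \<and> k < (Suc j)\<^sup>2"
proof (induction k)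
  case (Suc k)
  then obtain j where j: "j\<^sup>2 \<le> k" "k < (Suc j)\<^sup>2" by blast
  show ?case
  proof (cases "Suc k < (Suc j)\<^sup>2")
    case True
    then show ?thesis using j by (intro exI[of _ j]) auto
  next
    case False
    then show ?thesis using j
      by (intro exI[of _ "Suc j"]) (auto simp: power2_eq_square)
  qed
qed (auto intro!: exI[of _ 0])

lemma sum_tail_between_le:
  fixes x :: "nat \<Rightarrow> real"
  assumes "a \<le> k" "k \<le> b"
  shows "\<bar>\<Sum>i<k. x i\<bar> \<le> \<bar>\<Sum>i<a. x i\<bar> + (\<Sum>i\<in>{a..<b}. \<bar>x i\<bar>)"
proof -
  have "(\<Sum>i<k. x i) = (\<Sum>i<a. x i) + (\<Sum>i\<in>{a..<k}. x i)"
    using assms(1) by (metis atLeast0LessThan sum.atLeastLessThan_concat zero_le)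
  moreover have "\<bar>\<Sum>i\<in>{a..<k}. x i\<bar> \<le> (\<Sum>i\<in>{a..<k}. \<bar>x i\<bar>)" by (rule sum_abs)
  moreover have "(\<Sum>i\<in>{a..<k}. \<bar>x i\<bar>) \<le> (\<Sum>i\<in>{a..<b}. \<bar>x i\<bar>)"
    using assms by (intro sum_mono2) auto
  ultimately show ?thesis by linarith
qed

context prob_space
begin

text \<open>
  The second moment is too weak for a union bound over all \<open>k\<close>, as the probabilities only decay
  like \<open>1 / k\<close>. At the squares \<open>k = j\<^sup>2\<close> they decay like \<open>1 / j\<^sup>2\<close>; between two squares the partial
  sum moves by at most the sum of \<open>2 j + 1\<close> absolute values, whose second moment is of order
  \<open>j\<^sup>2\<close> by the Cauchy-Schwarz inequality and which thus exceeds \<open>c j\<^sup>2 / 2\<close> with a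
  probability of order \<open>1 / j\<^sup>2\<close> as well.
\<close>

lemma rare_large_sum_in_square_gap:
  fixes j :: nat
  assumes X: "linear_second_moments M V X" and c: "c > 0" and j: "j \<ge> 1"
  shows "rare M (40 * V / c\<^sup>2 * inverse (real j ^ 2))
     {\<omega>\<in>space M. \<exists>k. j\<^sup>2 \<le> k \<and> k < (Suc j)\<^sup>2 \<and> c * real k < \<bar>\<Sum>i<k. X i \<omega>\<bar>}"
proof -
  let ?a = "j\<^sup>2" and ?b = "(Suc j)\<^sup>2"
  define S where "S \<omega> = (\<Sum>i<?a. X i \<omega>)" for \<omega>
  define W where "W \<omega> = (\<Sum>i\<in>{?a..<?b}. \<bar>X i \<omega>\<bar>)" for \<omega>
  have S: "integrable M (\<lambda>\<omega>. (S \<omega>)\<^sup>2)" "expectation (\<lambda>\<omega>. (S \<omega>)\<^sup>2) \<le> V * real ?a"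
    using X[unfolded linear_second_moments_def, rule_format, of 0 ?a] by (simp_all add: S_def)
  have "integrable M (\<lambda>\<omega>. (\<Sum>i<1. X (a + i) \<omega>)\<^sup>2) \<and>
     expectation (\<lambda>\<omega>. (\<Sum>i<1. X (a + i) \<omega>)\<^sup>2) \<le> V * real 1" for a
    using X unfolding linear_second_moments_def by blast
  then have X1: "integrable M (\<lambda>\<omega>. (X a \<omega>)\<^sup>2)" "expectation (\<lambda>\<omega>. (X a \<omega>)\<^sup>2) \<le> V" for a
    by auto
  have V: "V \<ge> 0" using order_trans[OF Bochner_Integration.integral_nonneg X1(2)[of 0]] by simp
  have Wle: "(W \<omega>)\<^sup>2 \<le> real (2 * j + 1) * (\<Sum>i\<in>{?a..<?b}. (X i \<omega>)\<^sup>2)" for \<omega>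
  proof -
    have "?b - ?a = 2 * j + 1" by (simp add: power2_eq_square)
    then show ?thesis
      using sum_squared_le_sum_of_squares[of "\<lambda>i. \<bar>X i \<omega>\<bar>" "{?a..<?b}"]
      by (simp add: W_def mult.commute)
  qed
  define Q where "Q \<omega> = real (2 * j + 1) * (\<Sum>i\<in>{?a..<?b}. (X i \<omega>)\<^sup>2)" for \<omega>
  have Q: "integrable M Q" unfolding Q_def[abs_def] using X1 by auto
  have "expectation Q = real (2 * j + 1) * (\<Sum>i\<in>{?a..<?b}. expectation (\<lambda>\<omega>. (X i \<omega>)\<^sup>2))"
    unfolding Q_def[abs_def] using X1 by (simp add: Bochner_Integration.integral_sum)
  also have "\<dots> \<le> real (2 * j + 1) * (\<Sum>i\<in>{?a..<?b}. V)"
    by (intro mult_left_mono sum_mono X1) auto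
  also have "\<dots> = (2 * real j + 1)\<^sup>2 * V" by (simp add: power2_eq_square algebra_simps)
  also have "\<dots> \<le> (3 * real j)\<^sup>2 * V"
    using j V by (intro mult_right_mono power_mono) auto
  finally have EQ: "expectation Q \<le> 9 * real j ^ 2 * V" by (simp add: power_mult_distrib)
  let ?c = "c * real ?a / 2"
  have cp: "?c > 0" using c j by simp
  have "rare M (V * real ?a / ?c\<^sup>2) {\<omega>\<in>space M. ?c \<le> \<bar>S \<omega>\<bar>}"
    by (rule rare_Chebyshev[OF S cp])
  moreover have "rare M (9 * real j ^ 2 * V / ?c\<^sup>2) {\<omega>\<in>space M. ?c\<^sup>2 \<le> Q \<omega>}"
    using cp c j by (intro rare_Markov Q EQ) (auto simp: Q_def sum_nonneg)
  ultimately have "rare M (V * real ?a / ?c\<^sup>2 + 9 * real j ^ 2 * V / ?c\<^sup>2)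
      ({\<omega>\<in>space M. ?c \<le> \<bar>S \<omega>\<bar>} \<union> {\<omega>\<in>space M. ?c\<^sup>2 \<le> Q \<omega>})" (is "rare M ?p ?E")
    by (rule rare_Un)
  moreover have "?p = 40 * V / c\<^sup>2 * inverse (real j ^ 2)"
    using c j by (simp add: field_simps power2_eq_square)
  moreover have "{\<omega>\<in>space M. \<exists>k. j\<^sup>2 \<le> k \<and> k < (Suc j)\<^sup>2 \<and> c * real k < \<bar>\<Sum>i<k. X i \<omega>\<bar>} \<subseteq> ?E"
  proof (rule subsetI, rule ccontr)
    fix \<omega> assume "\<omega> \<in> {\<omega>\<in>space M. \<exists>k. j\<^sup>2 \<le> k \<and> k < (Suc j)\<^sup>2 \<and> c * real k < \<bar>\<Sum>i<k. X i \<omega>\<bar>}"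
      and nE: "\<omega> \<notin> ?E"
    then obtain k where \<omega>: "\<omega> \<in> space M" and k: "?a \<le> k" "k < ?b" "c * real k < \<bar>\<Sum>i<k. X i \<omega>\<bar>"
      by blast
    have "\<bar>S \<omega>\<bar> < ?c" "Q \<omega> < ?c\<^sup>2" using nE \<omega> by auto
    moreover have "W \<omega> < ?c"
      using Wle[of \<omega>] \<open>Q \<omega> < ?c\<^sup>2\<close> cp unfolding Q_def by (smt (verit) power_mono)
    moreover have "\<bar>\<Sum>i<k. X i \<omega>\<bar> \<le> \<bar>S \<omega>\<bar> + W \<omega>"
      unfolding S_def W_def using k by (intro sum_tail_between_le) auto
    moreover have "c * real ?a \<le> c * real k" using k c by (intro mult_left_mono) auto
    ultimately show False using k(3) by linarith
  qed
  ultimately show ?thesis by (auto intro: rare_mono)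
qed

text \<open>
  The bounds in the gaps between squares are summable in \<open>j\<close>, and \<open>N\<close> is chosen so that their tail
  is at most \<open>p\<close>. It depends on the process only through \<open>V\<close>, so it serves all starting points
  and both directions.
\<close>

lemma rare_partial_sum_above_line:
  assumes p: "p > 0" and c: "c > 0"
  obtains N :: nat where "N > 0" "\<And>X. linear_second_moments M V X \<Longrightarrow>
    rare M p {\<omega>\<in>space M. \<exists>k\<ge>N. c * real k < \<bar>\<Sum>i<k. X i \<omega>\<bar>}"
proof -
  define f where "f j = 40 * V / c\<^sup>2 * inverse (real j ^ 2)" for j
  have sm: "summable f"
    unfolding f_def by (intro summable_mult inverse_power_summable) auto
  obtain J0 where J0: "\<And>n. n \<ge> J0 \<Longrightarrow> norm (\<Sum>i. f (i + n)) < p"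
    using suminf_exist_split[OF p sm] by blast
  define J where "J = J0 + 1"
  have J: "J \<ge> 1" "(\<Sum>i. f (i + J)) < p" using J0[of J] by (auto simp: J_def)
  show thesis
  proof (rule that[of "J\<^sup>2"])
    show "J\<^sup>2 > 0" using J by simp
    fix X assume X: "linear_second_moments M V X"
    let ?A = "\<lambda>j. {\<omega>\<in>space M. \<exists>k. j\<^sup>2 \<le> k \<and> k < (Suc j)\<^sup>2 \<and> c * real k < \<bar>\<Sum>i<k. X i \<omega>\<bar>}"
    have "rare M (f (i + J)) (?A (i + J))" for i
      unfolding f_def using J by (intro rare_large_sum_in_square_gap X c) auto
    moreover have "summable (\<lambda>i. f (i + J))" using sm by (simp add: summable_iff_shift)
    ultimately have "rare M (\<Sum>i. f (i + J)) (\<Union>i. ?A (i + J))" by (rule rare_UN_nat)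
    moreover have "{\<omega>\<in>space M. \<exists>k\<ge>J\<^sup>2. c * real k < \<bar>\<Sum>i<k. X i \<omega>\<bar>} \<subseteq> (\<Union>i. ?A (i + J))"
    proof
      fix \<omega> assume "\<omega> \<in> {\<omega>\<in>space M. \<exists>k\<ge>J\<^sup>2. c * real k < \<bar>\<Sum>i<k. X i \<omega>\<bar>}"
      then obtain k where k: "\<omega> \<in> space M" "k \<ge> J\<^sup>2" "c * real k < \<bar>\<Sum>i<k. X i \<omega>\<bar>" by blast
      obtain j where j: "j\<^sup>2 \<le> k" "k < (Suc j)\<^sup>2" using between_squares by blast
      have "J\<^sup>2 < (Suc j)\<^sup>2" using k j by simp
      then have "J < Suc j" by (rule power_less_imp_less_base) simp
      then obtain i where "j = i + J" using le_Suc_ex[of J j] by (auto simp: add.commute)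
      then show "\<omega> \<in> (\<Union>i. ?A (i + J))" using k j by blast
    qed
    ultimately show "rare M p {\<omega>\<in>space M. \<exists>k\<ge>J\<^sup>2. c * real k < \<bar>\<Sum>i<k. X i \<omega>\<bar>}"
      using J by (auto intro: rare_mono)
  qed
qed

lemma truncated_second_moment_small:
  assumes "integrable M (\<lambda>\<omega>. (X \<omega>)\<^sup>2)" "X \<in> borel_measurable M" "q > 0"
  obtains K :: real where "K > 0"
    "expectation (\<lambda>\<omega>. (X \<omega>)\<^sup>2 * indicator {x. K < \<bar>x\<bar>} (X \<omega>)) < q"
proof -
  let ?f = "\<lambda>(k::nat) \<omega>. (X \<omega>)\<^sup>2 * indicator {x. real k < \<bar>x\<bar>} (X \<omega>)"
  note assms(2)[measurable]
  have "(\<lambda>k. expectation (?f k)) \<longlonglongrightarrow> expectation (\<lambda>\<omega>. 0)"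
  proof (rule integral_dominated_convergence[where w = "\<lambda>\<omega>. (X \<omega>)\<^sup>2"])
    show "AE \<omega> in M. (\<lambda>k. ?f k \<omega>) \<longlonglongrightarrow> 0"
    proof (rule AE_I2)
      fix \<omega>
      obtain k0 :: nat where k0: "\<bar>X \<omega>\<bar> < real k0" using reals_Archimedean2 by blast
      have "eventually (\<lambda>k. ?f k \<omega> = 0) sequentially"
        using eventually_ge_at_top[of k0]
        by eventually_elim (use k0 in \<open>auto simp: indicator_def\<close>)
      then show "(\<lambda>k. ?f k \<omega>) \<longlonglongrightarrow> 0" by (rule tendsto_eventually)
    qed
    show "AE \<omega> in M. norm (?f k \<omega>) \<le> (X \<omega>)\<^sup>2" for k by (auto simp: indicator_def)
  qed (use assms in auto)
  then have "eventually (\<lambda>k. expectation (?f k) < q) sequentially"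
    using assms(3) by (auto dest: order_tendstoD(2)[of _ _ _ q])
  then have "eventually (\<lambda>k. expectation (?f k) < q \<and> k > 0) sequentially"
    using eventually_gt_at_top by (rule eventually_conj)
  then obtain k where "expectation (?f k) < q" "k > 0"
    by (metis (no_types, lifting) eventually_sequentially order_refl)
  then show thesis using that[of "real k"] by simp
qed

text \<open>
  Windows of length at most \<open>\<theta> n\<close> are handled by the Cauchy-Schwarz inequality: the sum of the
  squares in the window is at most \<open>K\<^sup>2 \<theta> n\<close> plus the total contribution of the
  squared values above the truncation level \<open>K\<close>, which has expectation at most a small multiple of \<open>n\<close>.
  For longer windows a bound \<open>c n\<close> on all partial sums is enough, because \<open>b - a\<close> is itself of
  order \<open>n\<close>. The partial sums up to the index \<open>N\<close> of the maximal inequality are short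
  windows for large \<open>n\<close>, so that the first case covers them.
\<close>

lemma rare_large_window:
  fixes X :: "nat \<Rightarrow> 'a \<Rightarrow> real"
  assumes X: "linear_second_moments M V X"
    and meas: "\<And>i. X i \<in> borel_measurable M"
    and ident: "\<And>i. distr M borel (X i) = distr M borel (X 0)"
    and p: "p > 0" and \<zeta>: "\<zeta> > 0"
  shows "\<forall>\<^sub>F n in sequentially. rare M p {\<omega>\<in>space M. \<exists>a L. a + L \<le> n \<and>
           \<zeta> * real n * real L < (\<Sum>i<L. X (a + i) \<omega>)\<^sup>2}"
proof -
  note meas[measurable]
  have "integrable M (\<lambda>\<omega>. (\<Sum>i<1. X (a + i) \<omega>)\<^sup>2)" for a
    using X unfolding linear_second_moments_def by blast
  then have X1: "integrable M (\<lambda>\<omega>. (X a \<omega>)\<^sup>2)" for a by simp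
  obtain K where K: "K > 0"
    "expectation (\<lambda>\<omega>. (X 0 \<omega>)\<^sup>2 * indicator {x. K < \<bar>x\<bar>} (X 0 \<omega>)) < \<zeta> / 2 * (p / 2)"
    using truncated_second_moment_small[OF X1 meas, of "\<zeta> / 2 * (p / 2)" 0] p \<zeta> by auto
  define T where "T i \<omega> = (X i \<omega>)\<^sup>2 * indicator {x. K < \<bar>x\<bar>} (X i \<omega>)" for i \<omega>
  have Tint: "integrable M (T i)" for i
    unfolding T_def[abs_def] using X1[of i]
    by (rule Bochner_Integration.integrable_bound) (auto simp: indicator_def)
  have ET: "expectation (T i) \<le> \<zeta> / 2 * (p / 2)" for i
  proof -
    let ?f = "\<lambda>x::real. x\<^sup>2 * indicator {x. K < \<bar>x\<bar>} x"
    have "expectation (\<lambda>\<omega>. ?f (X j \<omega>)) = integral\<^sup>L (distr M borel (X j)) ?f" for j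
      by (subst integral_distr) auto
    then have "expectation (T i) = expectation (T 0)"
      unfolding T_def[abs_def] using ident[of i] by simp
    then show ?thesis using K(2) by (simp add: T_def[abs_def])
  qed
  define \<theta> where "\<theta> = \<zeta> / (2 * K\<^sup>2)"
  have \<theta>: "\<theta> > 0" "K\<^sup>2 * \<theta> = \<zeta> / 2" using K \<zeta> by (auto simp: \<theta>_def)
  (* A long window is a difference of two partial sums, so its square is at most
     4 c^2 n^2 = \<zeta> \<theta> n^2, which is below \<zeta> n L when L > \<theta> n. *)
  define c where "c = sqrt (\<zeta> * \<theta>) / 2"
  have c: "c > 0" "4 * c\<^sup>2 = \<zeta> * \<theta>" using \<theta> \<zeta> by (auto simp: c_def power_divide)
  obtain N where N: "N > 0"
    "\<And>X. linear_second_moments M V X \<Longrightarrow>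
      rare M (p/2) {\<omega>\<in>space M. \<exists>k\<ge>N. c * real k < \<bar>\<Sum>i<k. X i \<omega>\<bar>}"
    using rare_partial_sum_above_line[of "p/2" c V] p c by auto
  have "\<forall>\<^sub>F n in sequentially. real n \<ge> real N / \<theta>"
    by (rule eventually_sequentiallyI[of "nat \<lceil>real N / \<theta>\<rceil>"]) linarith
  moreover have "\<forall>\<^sub>F n in sequentially. real n \<ge> \<zeta> * real N / c\<^sup>2"
    by (rule eventually_sequentiallyI[of "nat \<lceil>\<zeta> * real N / c\<^sup>2\<rceil>"]) linarith
  ultimately show ?thesis using eventually_gt_at_top[of 0]
  proof eventually_elim
    case (elim n)
    have n: "n > 0" "real N \<le> \<theta> * real n" "\<zeta> * real N \<le> c\<^sup>2 * real n"
      using elim \<theta> c by (auto simp: field_simps)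
    let ?E1 = "{\<omega>\<in>space M. \<zeta> / 2 * real n \<le> (\<Sum>i<n. T i \<omega>)}"
    let ?E2 = "{\<omega>\<in>space M. \<exists>k\<ge>N. c * real k < \<bar>\<Sum>i<k. X i \<omega>\<bar>}"
    have "expectation (\<lambda>\<omega>. \<Sum>i<n. T i \<omega>) \<le> real n * (\<zeta> / 2 * (p / 2))"
      using sum_mono[of "{..<n}" "\<lambda>i. expectation (T i)" "\<lambda>_. \<zeta> / 2 * (p / 2)"] ET Tint
      by (simp add: Bochner_Integration.integral_sum)
    then have "rare M (real n * (\<zeta> / 2 * (p / 2)) / (\<zeta> / 2 * real n)) ?E1"
    proof (intro rare_Markov)
      show "integrable M (\<lambda>\<omega>. \<Sum>i<n. T i \<omega>)" using Tint by auto
      show "0 \<le> (\<Sum>i<n. T i \<omega>)" for \<omega> by (auto simp: T_def intro!: sum_nonneg)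
      show "0 < \<zeta> / 2 * real n" using n \<zeta> by simp
    qed
    also have "real n * (\<zeta> / 2 * (p / 2)) / (\<zeta> / 2 * real n) = p / 2"
      using n \<zeta> by (simp add: field_simps)
    finally have "rare M (p / 2 + p / 2) (?E1 \<union> ?E2)"
      by (rule rare_Un[OF _ N(2)[OF X]])
    moreover have "{\<omega>\<in>space M. \<exists>a L. a + L \<le> n \<and>
           \<zeta> * real n * real L < (\<Sum>i<L. X (a + i) \<omega>)\<^sup>2} \<subseteq> ?E1 \<union> ?E2"
    proof (rule subsetI, rule ccontr)
      fix \<omega> assume "\<omega> \<in> {\<omega>\<in>space M. \<exists>a L. a + L \<le> n \<and>
           \<zeta> * real n * real L < (\<Sum>i<L. X (a + i) \<omega>)\<^sup>2}" and nE: "\<omega> \<notin> ?E1 \<union> ?E2"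
      then obtain a L where \<omega>: "\<omega> \<in> space M" and aL: "a + L \<le> n"
        and big: "\<zeta> * real n * real L < (\<Sum>i<L. X (a + i) \<omega>)\<^sup>2" by blast
      have T: "(\<Sum>i<n. T i \<omega>) \<le> \<zeta> / 2 * real n" using nE \<omega> by auto
      have large: "\<bar>\<Sum>i<k. X i \<omega>\<bar> \<le> c * real k" if "k \<ge> N" for k
        using nE \<omega> that by force
      have short: "(\<Sum>i<l. X (b + i) \<omega>)\<^sup>2 \<le> \<zeta> * real n * real l"
        if bl: "b + l \<le> n" "real l \<le> \<theta> * real n" for b l
      proof -
        have "(X i \<omega>)\<^sup>2 \<le> K\<^sup>2 + T i \<omega>" for i
          using K(1) by (auto simp: T_def indicator_def abs_le_square_iff[symmetric])
        then have "(\<Sum>i<l. (X (b + i) \<omega>)\<^sup>2) \<le> (\<Sum>i<l. K\<^sup>2 + T (b + i) \<omega>)"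
          by (intro sum_mono)
        also have "\<dots> = K\<^sup>2 * real l + (\<Sum>i\<in>(\<lambda>i. b + i) ` {..<l}. T i \<omega>)"
          by (subst sum.reindex) (auto simp: sum.distrib)
        also have "\<dots> \<le> K\<^sup>2 * (\<theta> * real n) + (\<Sum>i<n. T i \<omega>)"
          using bl by (intro add_mono mult_left_mono sum_mono2) (auto simp: T_def)
        also have "\<dots> = \<zeta> / 2 * real n + (\<Sum>i<n. T i \<omega>)"
          using \<theta>(2) by (metis mult.assoc)
        also have "\<dots> \<le> \<zeta> * real n" using T by (simp add: field_simps)
        finally have le: "(\<Sum>i<l. (X (b + i) \<omega>)\<^sup>2) \<le> \<zeta> * real n" .
        have "(\<Sum>i<l. X (b + i) \<omega>)\<^sup>2 \<le> (\<Sum>i<l. (X (b + i) \<omega>)\<^sup>2) * real l"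
          using sum_squared_le_sum_of_squares[of "\<lambda>i. X (b + i) \<omega>" "{..<l}"] by simp
        also have "\<dots> \<le> \<zeta> * real n * real l" using le by (intro mult_right_mono) auto
        finally show ?thesis .
      qed
      have part: "\<bar>\<Sum>i<k. X i \<omega>\<bar> \<le> c * real n" if "k \<le> n" for k
      proof (cases "k \<ge> N")
        case True
        have "c * real k \<le> c * real n" using that c by (intro mult_left_mono) auto
        then show ?thesis using large[OF True] by linarith
      next
        case False
        then have "(\<Sum>i<k. X i \<omega>)\<^sup>2 \<le> \<zeta> * real n * real k"
          using short[of 0 k] n that by simp
        also have "\<dots> \<le> \<zeta> * real n * real N" using False \<zeta> by (intro mult_left_mono) auto
        also have "\<dots> = real n * (\<zeta> * real N)" by simp
        also have "\<dots> \<le> real n * (c\<^sup>2 * real n)" using n by (intro mult_left_mono) auto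
        also have "\<dots> = (c * real n)\<^sup>2" by (simp add: power2_eq_square)
        finally show ?thesis using c by (simp add: abs_le_square_iff[symmetric])
      qed
      show False
      proof (cases "real L \<le> \<theta> * real n")
        case True
        then show False using short[OF aL] big by simp
      next
        case False
        have "(\<Sum>i<a + L. X i \<omega>) = (\<Sum>i<a. X i \<omega>) + (\<Sum>i<L. X (a + i) \<omega>)"
          by (induction L) (auto simp: algebra_simps)
        then have "\<bar>\<Sum>i<L. X (a + i) \<omega>\<bar> \<le> \<bar>2 * (c * real n)\<bar>"
          using part[of a] part[of "a + L"] aL by linarith
        then have "(\<Sum>i<L. X (a + i) \<omega>)\<^sup>2 \<le> (2 * (c * real n))\<^sup>2"
          by (simp only: abs_le_square_iff)
        also have "\<dots> = (4 * c\<^sup>2) * real n * real n" by (simp add: power2_eq_square)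
        also have "\<dots> = \<zeta> * real n * (\<theta> * real n)" using c(2) by simp
        also have "\<dots> \<le> \<zeta> * real n * real L" using False \<zeta> by (intro mult_left_mono) auto
        finally show False using big by simp
      qed
    qed
    ultimately show ?case by (auto intro: rare_mono)
  qed
qed

end

section \<open>Least squares with a prescribed number of segments\<close>

definition residual_ss :: "nat \<Rightarrow> (nat \<Rightarrow> real) \<Rightarrow> (nat \<Rightarrow> real) \<Rightarrow> (nat \<Rightarrow> nat) \<Rightarrow> real" where
  "residual_ss m z d t = (\<Sum>k\<le>m. \<Sum>i\<in>{t k<..t (Suc k)}. (z i - d k)\<^sup>2)"

text \<open>
  The criterion depends on the data only through the quasi-differences.
\<close>

lemma SS_eq_residual_ss: "SS m x \<rho> d t = residual_ss m (\<lambda>i. x i - \<rho> * x (i - 1)) d t"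
  by (simp add: SS_def residual_ss_def atLeast0AtMost atLeastSucAtMost_greaterThanAtMost)

lemma segmentation_strict_mono:
  fixes t :: "nat \<Rightarrow> nat"
  assumes "\<And>k. k \<le> m \<Longrightarrow> t k < t (Suc k)" "i < j" "j \<le> Suc m"
  shows "t i < t j"
  using assms(2,3)
proof (induction j)
  case (Suc j)
  have "t j < t (Suc j)" using Suc.prems by (intro assms) auto
  moreover have "i = j \<or> i < j" using Suc.prems by auto
  ultimately show ?case using Suc by fastforce
qed simp

lemma segmentation_mono:
  fixes t :: "nat \<Rightarrow> nat"
  assumes "\<And>k. k \<le> m \<Longrightarrow> t k < t (Suc k)" "i \<le> j" "j \<le> Suc m"
  shows "t i \<le> t j"
  using segmentation_strict_mono[of m t i j] assms by (cases "i = j") force+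

lemma segment_containing:
  fixes t :: "nat \<Rightarrow> nat"
  assumes "t 0 < x" "x \<le> t (Suc m)"
  obtains j where "j \<le> m" "t j < x" "x \<le> t (Suc j)"
proof -
  have "\<exists>j\<le>m. t j < x \<and> x \<le> t (Suc j)"
    using assms(2)
  proof (induction m)
    case 0
    then show ?case using assms(1) by auto
  next
    case (Suc m)
    show ?case
    proof (cases "x \<le> t (Suc m)")
      case True
      then show ?thesis using Suc.IH le_SucI by blast
    next
      case False
      then show ?thesis using Suc.prems by (intro exI[of _ "Suc m"]) auto
    qed
  qed
  then show thesis using that by blast
qed

lemma sum_over_segments:
  fixes t :: "nat \<Rightarrow> nat" and f :: "nat \<Rightarrow> real"
  assumes "\<And>k. k \<le> m \<Longrightarrow> t k < t (Suc k)"
  shows "(\<Sum>k\<le>m. \<Sum>i\<in>A \<inter> {t k<..t (Suc k)}. f i) = (\<Sum>i\<in>A \<inter> {t 0<..t (Suc m)}. f i)"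
  using assms
proof (induction m)
  case (Suc m)
  have le: "t 0 \<le> t (Suc m)" "t (Suc m) \<le> t (Suc (Suc m))"
    using Suc.prems by (auto intro!: segmentation_mono[of "Suc m" t])
  have "(\<Sum>i\<in>A \<inter> {t 0<..t (Suc (Suc m))}. f i)
      = (\<Sum>i\<in>(A \<inter> {t 0<..t (Suc m)}) \<union> (A \<inter> {t (Suc m)<..t (Suc (Suc m))}). f i)"
    using le by (intro sum.cong) auto
  also have "\<dots> = (\<Sum>i\<in>A \<inter> {t 0<..t (Suc m)}. f i) + (\<Sum>i\<in>A \<inter> {t (Suc m)<..t (Suc (Suc m))}. f i)"
    by (intro sum.union_disjoint) auto
  finally show ?case using Suc by simp
qed simp

lemma strictly_increasing_self_map_id:
  fixes \<phi> :: "nat \<Rightarrow> nat"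
  assumes range: "\<And>k. 1 \<le> k \<Longrightarrow> k \<le> m \<Longrightarrow> 1 \<le> \<phi> k \<and> \<phi> k \<le> m"
    and mono: "\<And>k l. 1 \<le> k \<Longrightarrow> k < l \<Longrightarrow> l \<le> m \<Longrightarrow> \<phi> k < \<phi> l"
    and k: "1 \<le> k" "k \<le> m"
  shows "\<phi> k = k"
proof (rule antisym)
  have "1 \<le> l \<longrightarrow> l \<le> m \<longrightarrow> l \<le> \<phi> l" for l
  proof (induction l)
    case (Suc l)
    show ?case
    proof (cases "l = 0")
      case True
      then show ?thesis using range[of 1] by auto
    next
      case False
      then show ?thesis using Suc mono[of l "Suc l"] by auto
    qed
  qed simp
  then show "k \<le> \<phi> k" using k by blast
  have "l < m \<longrightarrow> \<phi> (m - l) \<le> m - l" for l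
  proof (induction l)
    case 0
    then show ?case using range[of m] by auto
  next
    case (Suc l)
    show ?case
    proof
      assume l: "Suc l < m"
      then have "\<phi> (m - Suc l) < \<phi> (m - l)" by (intro mono) auto
      moreover have "\<phi> (m - l) \<le> m - l" using Suc l by auto
      ultimately show "\<phi> (m - Suc l) \<le> m - Suc l" using l by linarith
    qed
  qed
  from this[of "m - k"] show "\<phi> k \<le> k" using k by auto
qed

text \<open>
  The quadratic in \<open>x\<close> behind every comparison of two levels on a common set of indices.
\<close>

lemma sum_square_shift:
  fixes e :: "'b \<Rightarrow> real"
  shows "(\<Sum>i\<in>I. (e i - x)\<^sup>2) = (\<Sum>i\<in>I. (e i)\<^sup>2) - 2 * x * (\<Sum>i\<in>I. e i) + x\<^sup>2 * real (card I)"
proof -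
  have "(\<Sum>i\<in>I. (e i - x)\<^sup>2) = (\<Sum>i\<in>I. (e i)\<^sup>2 + x\<^sup>2 - 2 * x * e i)"
    by (intro sum.cong refl) (simp add: power2_diff algebra_simps)
  also have "\<dots> = (\<Sum>i\<in>I. (e i)\<^sup>2) + (\<Sum>i\<in>I. x\<^sup>2) - 2 * x * (\<Sum>i\<in>I. e i)"
    unfolding sum_subtractf sum.distrib sum_distrib_left ..
  finally show ?thesis by simp
qed

text \<open>
  Fitting the errors \<open>e\<close> by a constant \<open>x\<close> gains at most \<open>2 x S - L x\<^sup>2\<close>. Half of the quadratic term
  pays for the linear one up to \<open>2 S\<^sup>2 / L\<close>, and the other half remains.
\<close>

lemma shift_cost_ge:
  fixes e :: "'b \<Rightarrow> real"
  assumes "(\<Sum>i\<in>I. e i)\<^sup>2 \<le> b * real (card I)" "0 \<le> b"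
  shows "real (card I) * x\<^sup>2 / 2 - 2 * b \<le> (\<Sum>i\<in>I. (e i - x)\<^sup>2) - (\<Sum>i\<in>I. (e i)\<^sup>2)"
proof -
  define L S where "L = real (card I)" and "S = (\<Sum>i\<in>I. e i)"
  have "2 * x * S \<le> L * x\<^sup>2 / 2 + 2 * b"
  proof (cases "L = 0")
    case True
    then have "S = 0" using assms(1) by (simp add: L_def S_def)
    then show ?thesis using True assms(2) by simp
  next
    case False
    then have L: "L > 0" by (simp add: L_def)
    have "L * (2 * x * S) \<le> L * (L * x\<^sup>2 / 2) + 2 * S\<^sup>2"
      using zero_le_power2[of "L * x - 2 * S"] by (simp add: power2_eq_square algebra_simps)
    also have "\<dots> \<le> L * (L * x\<^sup>2 / 2) + 2 * (b * L)" using assms(1) by (simp add: L_def S_def)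
    also have "\<dots> = L * (L * x\<^sup>2 / 2 + 2 * b)" by (simp add: algebra_simps)
    finally show ?thesis using L by simp
  qed
  then show ?thesis
    unfolding sum_square_shift L_def S_def by (simp add: algebra_simps)
qed

text \<open>
  Here \<open>x\<close> and \<open>y\<close> are the deviations of two candidate levels from the true one. The difference of
  the two costs is \<open>(x - y) ((x + y) L - 2 S)\<close>, and \<open>\<bar>x + y\<bar> \<ge> 3 \<kappa> / 4\<close> with the sign of \<open>x\<close>.
\<close>

lemma wrong_level_needs_large_noise:
  fixes e :: "'b \<Rightarrow> real"
  assumes "(\<Sum>i\<in>I. (e i - x)\<^sup>2) \<le> (\<Sum>i\<in>I. (e i - y)\<^sup>2)"
    and "\<bar>x\<bar> \<ge> 7 * \<kappa> / 8" "\<bar>y\<bar> \<le> \<kappa> / 8" "\<kappa> > 0"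
  shows "\<kappa> / 4 * real (card I) \<le> \<bar>\<Sum>i\<in>I. e i\<bar>"
proof -
  define L S where "L = real (card I)" and "S = (\<Sum>i\<in>I. e i)"
  have L: "L \<ge> 0" by (simp add: L_def)
  have le: "(x - y) * ((x + y) * L - 2 * S) \<le> 0"
    using assms(1) unfolding sum_square_shift L_def[symmetric] S_def[symmetric]
    by (simp add: algebra_simps power2_eq_square)
  have "\<kappa> / 4 * L \<le> \<bar>S\<bar>"
  proof (cases "x > 0")
    case True
    then have xy: "x - y > 0" "x + y \<ge> \<kappa> / 2" using assms by linarith+
    then have "(x + y) * L \<le> 2 * S" using le by (simp add: mult_le_0_iff)
    moreover have "\<kappa> / 2 * L \<le> (x + y) * L" using xy L by (intro mult_right_mono)
    ultimately show ?thesis by linarith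
  next
    case False
    then have xy: "x - y < 0" "- (x + y) \<ge> \<kappa> / 2" using assms by linarith+
    then have "(x + y) * L \<ge> 2 * S" using le by (simp add: mult_le_0_iff)
    moreover have "\<kappa> / 2 * L \<le> - (x + y) * L" using xy L by (intro mult_right_mono)
    ultimately show ?thesis by linarith
  qed
  then show ?thesis by (simp add: L_def S_def)
qed

lemma sum_greaterThanAtMost_concat:
  fixes f :: "nat \<Rightarrow> real"
  assumes "a \<le> b" "b \<le> c"
  shows "(\<Sum>i\<in>{a<..c}. f i) = (\<Sum>i\<in>{a<..b}. f i) + (\<Sum>i\<in>{b<..c}. f i)"
proof -
  have "{a<..c} = {a<..b} \<union> {b<..c}" using assms by auto
  then show ?thesis by (simp add: sum.union_disjoint)
qed

lemma residual_ss_two_segments: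
  assumes "k < m"
  shows "residual_ss m z d t = (\<Sum>i\<in>{t k<..t (Suc k)}. (z i - d k)\<^sup>2)
    + (\<Sum>i\<in>{t (Suc k)<..t (Suc (Suc k))}. (z i - d (Suc k))\<^sup>2)
    + (\<Sum>j\<in>{..m} - {k, Suc k}. \<Sum>i\<in>{t j<..t (Suc j)}. (z i - d j)\<^sup>2)"
proof -
  define g where "g j = (\<Sum>i\<in>{t j<..t (Suc j)}. (z i - d j)\<^sup>2)" for j
  have "sum g {..m} = g k + sum g ({..m} - {k})"
    by (rule sum.remove) (use assms in auto)
  also have "sum g ({..m} - {k}) = g (Suc k) + sum g ({..m} - {k} - {Suc k})"
    by (rule sum.remove) (use assms in auto)
  also have "{..m} - {k} - {Suc k} = {..m} - {k, Suc k}" by auto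
  finally show ?thesis unfolding residual_ss_def g_def by linarith
qed

lemma residual_ss_other_segments:
  "(\<Sum>j\<in>{..m} - {k, Suc k}. \<Sum>i\<in>{(t(Suc k := a)) j<..(t(Suc k := a)) (Suc j)}. (z i - d j)\<^sup>2)
    = (\<Sum>j\<in>{..m} - {k, Suc k}. \<Sum>i\<in>{t j<..t (Suc j)}. ((z i :: real) - d j)\<^sup>2)"
  by (intro sum.cong) auto

lemma residual_ss_upd:
  assumes "k < m"
  shows "residual_ss m z d (t(Suc k := a)) = (\<Sum>i\<in>{t k<..a}. (z i - d k)\<^sup>2)
    + (\<Sum>i\<in>{a<..t (Suc (Suc k))}. (z i - d (Suc k))\<^sup>2)
    + (\<Sum>j\<in>{..m} - {k, Suc k}. \<Sum>i\<in>{t j<..t (Suc j)}. (z i - d j)\<^sup>2)"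
  unfolding residual_ss_two_segments[OF assms] residual_ss_other_segments by simp

lemma residual_ss_move_left:
  assumes "k < m" "t k \<le> t (Suc k)" "t (Suc k) \<le> a" "a \<le> t (Suc (Suc k))"
  shows "residual_ss m z d t - residual_ss m z d (t(Suc k := a))
    = (\<Sum>i\<in>{t (Suc k)<..a}. (z i - d (Suc k))\<^sup>2) - (\<Sum>i\<in>{t (Suc k)<..a}. (z i - d k)\<^sup>2)"
  unfolding residual_ss_two_segments[OF assms(1), of z d t] residual_ss_upd[OF assms(1)]
    sum_greaterThanAtMost_concat[OF assms(2,3)] sum_greaterThanAtMost_concat[OF assms(3,4)]
  by linarith

lemma residual_ss_move_right:
  assumes "k < m" "t k \<le> a" "a \<le> t (Suc k)" "t (Suc k) \<le> t (Suc (Suc k))"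
  shows "residual_ss m z d t - residual_ss m z d (t(Suc k := a))
    = (\<Sum>i\<in>{a<..t (Suc k)}. (z i - d k)\<^sup>2) - (\<Sum>i\<in>{a<..t (Suc k)}. (z i - d (Suc k))\<^sup>2)"
  unfolding residual_ss_two_segments[OF assms(1), of z d t] residual_ss_upd[OF assms(1)]
    sum_greaterThanAtMost_concat[OF assms(2,3)] sum_greaterThanAtMost_concat[OF assms(3,4)]
  by linarith

text \<open>
  Observations \<open>z\<close> of a step function with levels \<open>\<beta>\<close> and segments \<open>s\<close>, disturbed by arbitrary
  errors \<open>e\<close>. All statements about the fit are deterministic consequences of bounds on sums of \<open>e\<close>.
\<close>

locale segmented_signal =
  fixes m n :: nat and s :: "nat \<Rightarrow> nat" and \<beta> e z :: "nat \<Rightarrow> real"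
  assumes s_0: "s 0 = 0" and s_end: "s (Suc m) = n"
    and s_less: "\<And>k. k \<le> m \<Longrightarrow> s k < s (Suc k)"
    and z_eq: "\<And>k i. k \<le> m \<Longrightarrow> s k < i \<Longrightarrow> i \<le> s (Suc k) \<Longrightarrow> z i = \<beta> k + e i"

lemma (in segmented_signal) s_mono: "i \<le> j \<Longrightarrow> j \<le> Suc m \<Longrightarrow> s i \<le> s j"
  using segmentation_mono[of m s i j] s_less by blast

lemma (in segmented_signal) sum_over_s:
  "(\<Sum>k\<le>m. \<Sum>i\<in>A \<inter> {s k<..s (Suc k)}. f i) = (\<Sum>i\<in>A \<inter> {s 0<..s (Suc m)}. (f i :: real))"
  by (rule sum_over_segments) (rule s_less)

locale fitted_segmentation = segmented_signal +
  fixes t :: "nat \<Rightarrow> nat" and d :: "nat \<Rightarrow> real"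
  assumes t_0: "t 0 = 0" and t_end: "t (Suc m) = n"
    and t_less: "\<And>k. k \<le> m \<Longrightarrow> t k < t (Suc k)"
begin

lemma t_mono: "i \<le> j \<Longrightarrow> j \<le> Suc m \<Longrightarrow> t i \<le> t j"
  using segmentation_mono[of m t i j] t_less by blast

lemma sum_over_t:
  "(\<Sum>k\<le>m. \<Sum>i\<in>A \<inter> {t k<..t (Suc k)}. f i) = (\<Sum>i\<in>A \<inter> {t 0<..t (Suc m)}. (f i :: real))"
  by (rule sum_over_segments) (rule t_less)

definition overlap :: "nat \<Rightarrow> nat \<Rightarrow> nat set" where
  "overlap k j = {s k<..s (Suc k)} \<inter> {t j<..t (Suc j)}"

lemma card_overlap: "real (min (s (Suc k)) (t (Suc j))) - real (max (s k) (t j)) \<le> real (card (overlap k j))"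
  by (simp add: overlap_def Int_greaterThanAtMost)

text \<open>
  Both residual sums of squares are written as sums over the overlaps of true and fitted segments.
  On an overlap the fit competes with the true level by a constant, and \<open>shift_cost_ge\<close> leaves half of
  the squared distance.
\<close>

lemma fit_error_le:
  assumes better: "residual_ss m z d t \<le> residual_ss m z \<beta> s"
    and noise: "\<And>a b. a \<le> b \<Longrightarrow> b \<le> n \<Longrightarrow> (\<Sum>i\<in>{a<..b}. e i)\<^sup>2 \<le> \<zeta> * real n * real (b - a)"
    and \<zeta>: "\<zeta> \<ge> 0"
  shows "(\<Sum>k\<le>m. \<Sum>j\<le>m. real (card (overlap k j)) * (d j - \<beta> k)\<^sup>2)
          \<le> 4 * (real m + 1)\<^sup>2 * \<zeta> * real n" (is "?G \<le> _")
proof -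
  have in_range: "{s k<..s (Suc k)} \<inter> {t 0<..t (Suc m)} = {s k<..s (Suc k)}"
    "{t k<..t (Suc k)} \<inter> {s 0<..s (Suc m)} = {t k<..t (Suc k)}" if "k \<le> m" for k
    using s_mono[of "Suc k" "Suc m"] t_mono[of "Suc k" "Suc m"]
      that by (auto simp: s_0 t_0 s_end t_end)
  have "residual_ss m z d t = (\<Sum>j\<le>m. \<Sum>k\<le>m. \<Sum>i\<in>{t j<..t (Suc j)} \<inter> {s k<..s (Suc k)}. (z i - d j)\<^sup>2)"
    unfolding residual_ss_def by (rule sum.cong[OF refl]) (simp only: sum_over_s in_range atMost_iff)
  also have "\<dots> = (\<Sum>k\<le>m. \<Sum>j\<le>m. \<Sum>i\<in>overlap k j. (z i - d j)\<^sup>2)"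
    unfolding overlap_def by (subst sum.swap) (simp only: Int_commute)
  also have "\<dots> = (\<Sum>k\<le>m. \<Sum>j\<le>m. \<Sum>i\<in>overlap k j. (e i - (d j - \<beta> k))\<^sup>2)"
    by (intro sum.cong refl) (auto simp: overlap_def z_eq algebra_simps)
  finally have R1: "residual_ss m z d t = \<dots>" .
  have "residual_ss m z \<beta> s = (\<Sum>k\<le>m. \<Sum>j\<le>m. \<Sum>i\<in>overlap k j. (z i - \<beta> k)\<^sup>2)"
    unfolding residual_ss_def overlap_def
    by (rule sum.cong[OF refl]) (simp only: sum_over_t in_range atMost_iff)
  also have "\<dots> = (\<Sum>k\<le>m. \<Sum>j\<le>m. \<Sum>i\<in>overlap k j. (e i)\<^sup>2)"
    by (intro sum.cong refl) (auto simp: overlap_def z_eq)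
  finally have R2: "residual_ss m z \<beta> s = \<dots>" .
  have piece: "real (card (overlap k j)) * (d j - \<beta> k)\<^sup>2 / 2 - 2 * (\<zeta> * real n)
      \<le> (\<Sum>i\<in>overlap k j. (e i - (d j - \<beta> k))\<^sup>2) - (\<Sum>i\<in>overlap k j. (e i)\<^sup>2)"
    if "k \<le> m" for k j
  proof (rule shift_cost_ge)
    (* An overlap is itself a window, or empty. *)
    have "s (Suc k) \<le> n" using s_mono[of "Suc k" "Suc m"] that s_end by auto
    then show "(\<Sum>i\<in>overlap k j. e i)\<^sup>2 \<le> \<zeta> * real n * real (card (overlap k j))"
      using noise[of "max (s k) (t j)" "min (s (Suc k)) (t (Suc j))"] \<zeta>
      by (cases "max (s k) (t j) \<le> min (s (Suc k)) (t (Suc j))")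
         (auto simp: overlap_def Int_greaterThanAtMost)
  qed (use \<zeta> in simp)
  have total: "(\<Sum>k\<le>m. \<Sum>j\<le>m. f k j / 2 - 2 * c) = (\<Sum>k\<le>m. \<Sum>j\<le>m. f k j) / 2 - 2 * (real m + 1)\<^sup>2 * c"
    for f :: "nat \<Rightarrow> nat \<Rightarrow> real" and c
    by (simp add: sum_subtractf sum_divide_distrib[symmetric] power2_eq_square algebra_simps)
  have "?G / 2 - 2 * (real m + 1)\<^sup>2 * (\<zeta> * real n)
      = (\<Sum>k\<le>m. \<Sum>j\<le>m. real (card (overlap k j)) * (d j - \<beta> k)\<^sup>2 / 2 - 2 * (\<zeta> * real n))"
    by (simp only: total)
  also have "\<dots> \<le> (\<Sum>k\<le>m. \<Sum>j\<le>m.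
      (\<Sum>i\<in>overlap k j. (e i - (d j - \<beta> k))\<^sup>2) - (\<Sum>i\<in>overlap k j. (e i)\<^sup>2))"
    by (intro sum_mono piece) auto
  also have "\<dots> = residual_ss m z d t - residual_ss m z \<beta> s"
    unfolding R1 R2 by (simp only: sum_subtractf)
  also have "\<dots> \<le> 0" using better by simp
  finally show ?thesis by (simp add: algebra_simps)
qed

context
  fixes \<gamma> \<kappa> :: real
  assumes \<gamma>: "\<gamma> > 0" and \<kappa>: "\<kappa> > 0" and n_pos: "n > 0"
    and gap: "\<And>k. k \<le> m \<Longrightarrow> \<gamma> * real n \<le> real (s (Suc k)) - real (s k)"
    and jump: "\<And>k. k < m \<Longrightarrow> \<kappa> \<le> \<bar>\<beta> (Suc k) - \<beta> k\<bar>"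
    and small_error: "(\<Sum>k\<le>m. \<Sum>j\<le>m. real (card (overlap k j)) * (d j - \<beta> k)\<^sup>2)
          \<le> \<gamma> * \<kappa>\<^sup>2 / 250 * real n"
begin

lemma overlap_term_le:
  assumes "A \<subseteq> {..m}" "j \<le> m"
  shows "(\<Sum>k\<in>A. real (card (overlap k j)) * (d j - \<beta> k)\<^sup>2) \<le> \<gamma> * \<kappa>\<^sup>2 / 250 * real n"
proof -
  have "(\<Sum>k\<in>A. real (card (overlap k j)) * (d j - \<beta> k)\<^sup>2)
      \<le> (\<Sum>k\<in>{..m}. real (card (overlap k j)) * (d j - \<beta> k)\<^sup>2)"
    using assms by (intro sum_mono2) auto
  also have "\<dots> \<le> (\<Sum>k\<le>m. \<Sum>j\<le>m. real (card (overlap k j)) * (d j - \<beta> k)\<^sup>2)"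
    using assms(2) by (intro sum_mono member_le_sum) auto
  finally show ?thesis using small_error by linarith
qed

text \<open>
  Otherwise one fitted segment overlaps both neighbouring true segments in at least
  \<open>\<gamma> n / 4\<close> points, and whatever its level is, the squared distance to the two true levels is at
  least \<open>\<kappa>\<^sup>2 / 2\<close> in total. This exceeds the available error.
\<close>

lemma near_some_fitted_change:
  assumes k: "k < m"
  shows "\<exists>j. 1 \<le> j \<and> j \<le> m \<and> \<bar>real (t j) - real (s (Suc k))\<bar> < \<gamma> / 4 * real n"
proof (rule ccontr)
  assume far: "\<not> ?thesis"
  let ?q = "\<gamma> / 4 * real n"
  have q: "?q > 0" "?q < \<gamma> * real n" using \<gamma> n_pos by auto
  have s0: "\<gamma> * real n \<le> real (s (Suc k)) - real (s k)" "\<gamma> * real n \<le> real (s (Suc (Suc k))) - real (s (Suc k))"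
    using gap[of k] gap[of "Suc k"] k by auto
  have ends: "s (Suc (Suc k)) \<le> n" using s_mono[of "Suc (Suc k)" "Suc m"] k s_end by auto
  obtain j where j: "j \<le> m" "t j < s (Suc k)" "s (Suc k) \<le> t (Suc j)"
    using segment_containing[of t "s (Suc k)" m] ends s0 q t_0 t_end s_less[of "Suc k"] k by force
  have far: "\<not> \<bar>real (t j) - real (s (Suc k))\<bar> < ?q" if "1 \<le> j" "j \<le> m" for j
    using far that by blast
  have left: "real (t j) \<le> real (s (Suc k)) - ?q"
  proof (cases "j = 0")
    case True
    then show ?thesis using s0 q t_0 by simp
  next
    case False
    then show ?thesis using far[of j] j by linarith
  qed
  have right: "real (t (Suc j)) \<ge> real (s (Suc k)) + ?q"
  proof (cases "j = m")
    case True
    then show ?thesis using s0 q t_end ends by simp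
  next
    case False
    then show ?thesis using far[of "Suc j"] j by linarith
  qed
  have c1: "?q \<le> real (card (overlap k j))"
    using card_overlap[of k j] left right s0 q j by (auto simp: min_def max_def split: if_splits)
  have c2: "?q \<le> real (card (overlap (Suc k) j))"
    using card_overlap[of "Suc k" j] left right s0 q j by (auto simp: min_def max_def split: if_splits)
  have "\<kappa>\<^sup>2 \<le> (\<beta> (Suc k) - \<beta> k)\<^sup>2"
    using jump[OF k] \<kappa> by (metis abs_ge_zero abs_le_square_iff abs_of_pos)
  also have "\<dots> \<le> 2 * (d j - \<beta> k)\<^sup>2 + 2 * (d j - \<beta> (Suc k))\<^sup>2"
    using square_sum_two[of "d j - \<beta> k" "- (d j - \<beta> (Suc k))"] unfolding power2_minus by simp
  finally have "?q * (\<kappa>\<^sup>2 / 2) \<le> ?q * ((d j - \<beta> k)\<^sup>2 + (d j - \<beta> (Suc k))\<^sup>2)"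
    using q by (intro mult_left_mono) auto
  also have "\<dots> \<le> (\<Sum>k'\<in>{k, Suc k}. real (card (overlap k' j)) * (d j - \<beta> k')\<^sup>2)"
    using mult_right_mono[OF c1, of "(d j - \<beta> k)\<^sup>2"] mult_right_mono[OF c2, of "(d j - \<beta> (Suc k))\<^sup>2"]
    by (simp add: distrib_left)
  also have "\<dots> \<le> \<gamma> * \<kappa>\<^sup>2 / 250 * real n" using k j by (intro overlap_term_le) auto
  finally have "\<gamma> * \<kappa>\<^sup>2 * real n \<le> 0" by (simp add: mult_ac)
  moreover have "\<gamma> * \<kappa>\<^sup>2 * real n > 0" using \<gamma> \<kappa> n_pos by simp
  ultimately show False by linarith
qed

text \<open>
  The true changes are more than \<open>\<gamma> n / 2\<close> apart, so the fitted changes found near them are in the same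
  order; \<open>m\<close> of them among \<open>m\<close> leaves only the identity as matching.
\<close>

lemma fitted_changes_consistent:
  assumes "k \<le> Suc m"
  shows "\<bar>real (t k) - real (s k)\<bar> < \<gamma> / 4 * real n"
proof -
  have q: "\<gamma> / 4 * real n > 0" using \<gamma> n_pos by auto
  have ex: "\<forall>k\<in>{1..m}. \<exists>j. 1 \<le> j \<and> j \<le> m \<and> \<bar>real (t j) - real (s k)\<bar> < \<gamma> / 4 * real n"
  proof
    fix k assume "k \<in> {1..m}"
    then show "\<exists>j. 1 \<le> j \<and> j \<le> m \<and> \<bar>real (t j) - real (s k)\<bar> < \<gamma> / 4 * real n"
      using near_some_fitted_change[of "k - 1"] by auto
  qed
  obtain \<phi> where \<phi>: "\<And>k. 1 \<le> k \<Longrightarrow> k \<le> m \<Longrightarrow> 1 \<le> \<phi> k \<and> \<phi> k \<le> m \<and>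
      \<bar>real (t (\<phi> k)) - real (s k)\<bar> < \<gamma> / 4 * real n"
    using bchoice[OF ex] by (metis atLeastAtMost_iff)
  have mono: "\<phi> k < \<phi> l" if "1 \<le> k" "k < l" "l \<le> m" for k l
  proof (rule ccontr)
    assume "\<not> \<phi> k < \<phi> l"
    then have "real (t (\<phi> l)) \<le> real (t (\<phi> k))"
      using \<phi>[of k] that t_mono[of "\<phi> l" "\<phi> k"] by auto
    moreover have "real (s (Suc k)) \<le> real (s l)" using that s_mono[of "Suc k" l] by auto
    moreover have "\<bar>real (t (\<phi> k)) - real (s k)\<bar> < \<gamma> / 4 * real n"
      "\<bar>real (t (\<phi> l)) - real (s l)\<bar> < \<gamma> / 4 * real n" using \<phi> that by auto
    ultimately show False using gap[of k] q that by linarith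
  qed
  consider "k = 0" | "k = Suc m" | "1 \<le> k" "k \<le> m" using assms by linarith
  then show ?thesis
  proof cases
    case 3
    have "\<phi> k = k" using \<phi> mono 3 by (intro strictly_increasing_self_map_id[of m \<phi>]) auto
    then show ?thesis using \<phi>[OF 3] by simp
  qed (use q s_0 t_0 s_end t_end in auto)
qed

lemma fitted_levels_consistent:
  assumes k: "k \<le> m"
  shows "\<bar>d k - \<beta> k\<bar> \<le> \<kappa> / 8"
proof -
  have "\<gamma> / 2 * real n \<le> real (card (overlap k k))"
    using card_overlap[of k k] gap[OF k] fitted_changes_consistent[of k] fitted_changes_consistent[of "Suc k"] k
    by (auto simp: min_def max_def split: if_splits)
  then have "\<gamma> / 2 * real n * (d k - \<beta> k)\<^sup>2 \<le> real (card (overlap k k)) * (d k - \<beta> k)\<^sup>2"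
    by (intro mult_right_mono) auto
  also have "\<dots> \<le> \<gamma> * \<kappa>\<^sup>2 / 250 * real n" using overlap_term_le[of "{k}" k] k by simp
  finally have "(\<gamma> * real n) * (d k - \<beta> k)\<^sup>2 \<le> (\<gamma> * real n) * (\<kappa>\<^sup>2 / 125)" by (simp add: mult_ac)
  then have "(d k - \<beta> k)\<^sup>2 \<le> \<kappa>\<^sup>2 / 125" using \<gamma> n_pos mult_le_cancel_left_pos[of "\<gamma> * real n"] by simp
  also have "\<dots> \<le> (\<kappa> / 8)\<^sup>2" by (simp add: power_divide)
  finally show ?thesis using \<kappa> by (simp add: abs_le_square_iff[symmetric])
qed

text \<open>
  The fitted change is moved to its true position and nothing else is altered. On the window in
  between, the true level is that of one side, from which the fitted level of the other side is
  at distance at least \<open>\<kappa> - \<kappa> / 8\<close>.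
\<close>

lemma fitted_change_rate:
  fixes C :: nat
  assumes k: "k < m"
    and opt: "residual_ss m z d t \<le> residual_ss m z d (t(Suc k := s (Suc k)))"
    and left: "\<And>L. L \<ge> C \<Longrightarrow> L \<le> s (Suc k) \<Longrightarrow>
        \<bar>\<Sum>i\<in>{s (Suc k) - L<..s (Suc k)}. e i\<bar> < \<kappa> / 4 * real L"
    and right: "\<And>L. L \<ge> C \<Longrightarrow> s (Suc k) + L \<le> n \<Longrightarrow>
        \<bar>\<Sum>i\<in>{s (Suc k)<..s (Suc k) + L}. e i\<bar> < \<kappa> / 4 * real L"
  shows "\<bar>real (t (Suc k)) - real (s (Suc k))\<bar> \<le> real C"
proof (rule ccontr)
  assume far: "\<not> ?thesis"
  have close: "\<bar>real (t j) - real (s j)\<bar> < \<gamma> / 4 * real n" if "j \<le> Suc m" for j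
    using fitted_changes_consistent[OF that] .
  have lev: "\<bar>d k - \<beta> k\<bar> \<le> \<kappa> / 8" "\<bar>d (Suc k) - \<beta> (Suc k)\<bar> \<le> \<kappa> / 8"
    using fitted_levels_consistent k by auto
  have jmp: "\<kappa> \<le> \<bar>\<beta> (Suc k) - \<beta> k\<bar>" by (rule jump[OF k])
  have "0 < \<gamma> * real n" using \<gamma> n_pos by simp
  moreover have "\<gamma> * real n \<le> real (s (Suc k)) - real (s k)"
    "\<gamma> * real n \<le> real (s (Suc (Suc k))) - real (s (Suc k))" using gap k by auto
  moreover note close[of k] close[of "Suc k"] close[of "Suc (Suc k)"]
  ultimately have "real (t k) < real (s (Suc k))" "real (s (Suc k)) < real (t (Suc (Suc k)))"
    "real (s k) < real (t (Suc k))" "real (t (Suc k)) < real (s (Suc (Suc k)))"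
    using k by linarith+
  then have order: "t k < s (Suc k)" "s (Suc k) < t (Suc (Suc k))"
    "s k < t (Suc k)" "t (Suc k) < s (Suc (Suc k))" "t k < t (Suc k)" "t (Suc k) < t (Suc (Suc k))"
    using t_less k by auto
  consider "t (Suc k) < s (Suc k)" | "s (Suc k) < t (Suc k)" using far by fastforce
  then show False
  proof cases
    case 1
    let ?I = "{t (Suc k)<..s (Suc k)}"
    have "(\<Sum>i\<in>?I. (z i - d (Suc k))\<^sup>2) \<le> (\<Sum>i\<in>?I. (z i - d k)\<^sup>2)"
      using residual_ss_move_left[of k m t "s (Suc k)" z d] opt k 1 order by simp
    moreover have "z i = \<beta> k + e i" if "i \<in> ?I" for i
      using that k order by (intro z_eq) auto
    ultimately have "(\<Sum>i\<in>?I. (e i - (d (Suc k) - \<beta> k))\<^sup>2) \<le> (\<Sum>i\<in>?I. (e i - (d k - \<beta> k))\<^sup>2)"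
      by (simp add: algebra_simps)
    then have "\<kappa> / 4 * real (card ?I) \<le> \<bar>\<Sum>i\<in>?I. e i\<bar>"
      by (rule wrong_level_needs_large_noise) (use lev jmp \<kappa> in linarith)+
    moreover have "C \<le> s (Suc k) - t (Suc k)" using far 1 by linarith
    ultimately show False using left[of "s (Suc k) - t (Suc k)"] 1 by simp
  next
    case 2
    let ?I = "{s (Suc k)<..t (Suc k)}"
    have "(\<Sum>i\<in>?I. (z i - d k)\<^sup>2) \<le> (\<Sum>i\<in>?I. (z i - d (Suc k))\<^sup>2)"
      using residual_ss_move_right[of k m t "s (Suc k)" z d] opt k 2 order by simp
    moreover have "z i = \<beta> (Suc k) + e i" if "i \<in> ?I" for i
      using that k order by (intro z_eq) auto
    ultimately have "(\<Sum>i\<in>?I. (e i - (d k - \<beta> (Suc k)))\<^sup>2) \<le> (\<Sum>i\<in>?I. (e i - (d (Suc k) - \<beta> (Suc k)))\<^sup>2)"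
      by (simp add: algebra_simps)
    then have "\<kappa> / 4 * real (card ?I) \<le> \<bar>\<Sum>i\<in>?I. e i\<bar>"
      by (rule wrong_level_needs_large_noise) (use lev jmp \<kappa> in linarith)+
    moreover have "C \<le> t (Suc k) - s (Suc k)" using far 2 by linarith
    moreover have "t (Suc k) \<le> n" using t_mono[of "Suc k" "Suc m"] t_end k by simp
    ultimately show False using right[of "t (Suc k) - s (Suc k)"] 2 by simp
  qed
qed

end

text \<open>
  The competitor uses the true level on the \<open>k\<close>-th fitted segment. Optimality gives
  \<open>\<bar>x\<bar> L \<le> 2 \<bar>\<Sum> u\<^sub>i\<bar>\<close> for the error \<open>x\<close> of the level, where \<open>u\<^sub>i = z\<^sub>i - \<beta>\<^sub>k\<close> differs from
  \<open>e\<^sub>i\<close> only at the at most \<open>2 C\<close> points outside the true segment, and there by at most \<open>2 B\<close>.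
\<close>

lemma fitted_level_error_le:
  assumes k: "k \<le> m"
    and opt: "residual_ss m z d t \<le> residual_ss m z (d(k := \<beta> k)) t"
    and close: "\<And>j. j \<le> Suc m \<Longrightarrow> \<bar>real (t j) - real (s j)\<bar> \<le> real C"
    and bound: "\<And>j. j \<le> m \<Longrightarrow> \<bar>\<beta> j\<bar> \<le> B"
  shows "\<bar>d k - \<beta> k\<bar> * (real (t (Suc k)) - real (t k)) \<le> 2 * \<bar>\<Sum>i\<in>{t k<..t (Suc k)}. e i\<bar> + 8 * B * real C"
proof -
  let ?T = "{t k<..t (Suc k)}" and ?S = "{s k<..s (Suc k)}"
  define x u where "x = d k - \<beta> k" and "u i = z i - \<beta> k" for i
  have B: "B \<ge> 0" using bound[of 0] by simp
  have tk: "t k < t (Suc k)" using t_less k .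
  have split: "residual_ss m z d' t = (\<Sum>i\<in>?T. (z i - d' k)\<^sup>2) + (\<Sum>j\<in>{..m} - {k}. \<Sum>i\<in>{t j<..t (Suc j)}. (z i - d' j)\<^sup>2)" for d'
    unfolding residual_ss_def using k by (subst sum.remove[of _ k]) auto
  have "(\<Sum>j\<in>{..m} - {k}. \<Sum>i\<in>{t j<..t (Suc j)}. (z i - (d(k := \<beta> k)) j)\<^sup>2)
      = (\<Sum>j\<in>{..m} - {k}. \<Sum>i\<in>{t j<..t (Suc j)}. (z i - d j)\<^sup>2)"
    by (intro sum.cong) auto
  then have "(\<Sum>i\<in>?T. (z i - d k)\<^sup>2) \<le> (\<Sum>i\<in>?T. (z i - \<beta> k)\<^sup>2)"
    using opt unfolding split by simp
  then have "(\<Sum>i\<in>?T. (u i - x)\<^sup>2) \<le> (\<Sum>i\<in>?T. (u i)\<^sup>2)" by (simp add: u_def x_def)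
  then have *: "x\<^sup>2 * real (card ?T) \<le> 2 * x * (\<Sum>i\<in>?T. u i)" unfolding sum_square_shift by simp
  have "\<bar>x\<bar> * (\<bar>x\<bar> * real (card ?T)) \<le> \<bar>x\<bar> * (2 * \<bar>\<Sum>i\<in>?T. u i\<bar>)"
  proof -
    have "\<bar>x\<bar> * (\<bar>x\<bar> * real (card ?T)) = x\<^sup>2 * real (card ?T)" by (simp add: power2_eq_square)
    also have "\<dots> \<le> \<bar>2 * x * (\<Sum>i\<in>?T. u i)\<bar>" using * by linarith
    finally show ?thesis by (simp add: abs_mult mult_ac)
  qed
  then have main: "\<bar>x\<bar> * real (card ?T) \<le> 2 * \<bar>\<Sum>i\<in>?T. u i\<bar>"
    by (cases "x = 0") auto
  have dev: "\<bar>u i - e i\<bar> \<le> (if i \<in> ?S then 0 else 2 * B)" if "i \<in> ?T" for i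
  proof -
    have "0 < i" "i \<le> n" using that t_mono[of "Suc k" "Suc m"] t_end k by auto
    then obtain j where j: "j \<le> m" "s j < i" "i \<le> s (Suc j)"
      using segment_containing[of s i m] s_0 s_end by auto
    show ?thesis
    proof (cases "i \<in> ?S")
      case True
      then show ?thesis using z_eq[of k i] k by (simp add: u_def)
    next
      case False
      moreover have "u i - e i = \<beta> j - \<beta> k" using z_eq[OF j] by (simp add: u_def)
      moreover have "\<bar>\<beta> j - \<beta> k\<bar> \<le> 2 * B" using bound[OF j(1)] bound[OF k] by linarith
      ultimately show ?thesis by (simp only: if_False)
    qed
  qed
  have "\<bar>(\<Sum>i\<in>?T. u i) - (\<Sum>i\<in>?T. e i)\<bar> \<le> (\<Sum>i\<in>?T. \<bar>u i - e i\<bar>)"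
    unfolding sum_subtractf[symmetric] by (rule sum_abs)
  also have "\<dots> \<le> (\<Sum>i\<in>?T. if i \<in> ?S then 0 else 2 * B)" by (intro sum_mono dev)
  also have "\<dots> = (\<Sum>i\<in>?T - ?S. 2 * B)"
    by (rule sum.mono_neutral_cong_right) auto
  also have "\<dots> = 2 * B * real (card (?T - ?S))" by simp
  also have "\<dots> \<le> 2 * B * (2 * real C)"
  proof (rule mult_left_mono)
    have "card (?T - ?S) \<le> card ({t k<..s k} \<union> {s (Suc k)<..t (Suc k)})"
      by (intro card_mono) auto
    also have "\<dots> \<le> (s k - t k) + (t (Suc k) - s (Suc k))"
      by (rule order_trans[OF card_Un_le]) simp
    finally show "real (card (?T - ?S)) \<le> 2 * real C"
      using close[of k] close[of "Suc k"] k by linarith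
  qed (use B in simp)
  finally have "\<bar>\<Sum>i\<in>?T. u i\<bar> \<le> \<bar>\<Sum>i\<in>?T. e i\<bar> + 4 * B * real C" by linarith
  moreover have "real (card ?T) = real (t (Suc k)) - real (t k)" using tk by (simp add: of_nat_diff)
  ultimately show ?thesis using main by (simp add: x_def)
qed

end

section \<open>Step functions observed with AR(1) errors\<close>

lemma finite_positive_lower_bound:
  fixes f :: "'b \<Rightarrow> real"
  assumes "finite A" "\<And>x. x \<in> A \<Longrightarrow> f x > 0"
  obtains c where "c > 0" "\<And>x. x \<in> A \<Longrightarrow> c \<le> f x"
proof -
  have "\<exists>c>0. \<forall>x\<in>A. c \<le> f x"
    using assms
  proof (induction A rule: finite_induct)
    case empty
    then show ?case by (auto intro: exI[of _ 1])
  next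
    case (insert x A)
    then obtain c where "c > 0" "\<forall>x\<in>A. c \<le> f x" by auto
    then show ?case using insert by (intro exI[of _ "min c (f x)"]) auto
  qed
  then show thesis using that by blast
qed

lemma finite_upper_bound:
  fixes f :: "'b \<Rightarrow> real"
  assumes "finite A"
  obtains B where "B > 0" "\<And>x. x \<in> A \<Longrightarrow> \<bar>f x\<bar> \<le> B"
proof -
  have "\<bar>f x\<bar> \<le> 1 + (\<Sum>x\<in>A. \<bar>f x\<bar>)" if "x \<in> A" for x
    using member_le_sum[of x A "\<lambda>x. \<bar>f x\<bar>"] that assms by auto
  moreover have "1 + (\<Sum>x\<in>A. \<bar>f x\<bar>) > 0" using sum_nonneg[of A "\<lambda>x. \<bar>f x\<bar>"] by linarith
  ultimately show thesis using that by blast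
qed

lemma eventually_real_ge: "\<forall>\<^sub>F n in sequentially. c \<le> real n"
  by (rule eventually_sequentiallyI[of "nat \<lceil>c\<rceil>"]) linarith

text \<open>
  The constants \<open>\<gamma>\<close>, \<open>\<kappa>\<close> and \<open>B\<close> quantify the separation of the change-points, the size of the
  jumps and the size of the means. Both lower bounds are assumed with a factor \<open>2\<close> in reserve: one
  is lost to rounding the change-points to integers, the other to replacing \<open>\<rho>\<close> by its estimate.
\<close>

locale AR1_change_points = prob_space M
  for M :: "'a measure" +
  fixes m :: nat
    and \<tau> \<mu> :: "nat \<Rightarrow> real" and \<rho> \<sigma> :: real
    and \<epsilon> \<eta> :: "int \<Rightarrow> 'a \<Rightarrow> real"
    and y :: "nat \<Rightarrow> nat \<Rightarrow> 'a \<Rightarrow> real"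
    and \<rho>_bar :: "nat \<Rightarrow> 'a \<Rightarrow> real" and \<Delta> :: "nat \<Rightarrow> real"
    and \<delta>_hat :: "nat \<Rightarrow> 'a \<Rightarrow> nat \<Rightarrow> real" and t_hat :: "nat \<Rightarrow> 'a \<Rightarrow> nat \<Rightarrow> nat"
    and \<gamma> \<kappa> B :: real
  assumes \<tau>_0: "\<tau> 0 = 0" and \<tau>_end: "\<tau> (m + 1) = 1"
    and \<gamma>_pos: "\<gamma> > 0" and \<tau>_gap: "\<And>k. k \<le> m \<Longrightarrow> 2 * \<gamma> \<le> \<tau> (Suc k) - \<tau> k"
    and \<kappa>_pos: "\<kappa> > 0" and \<mu>_jump: "\<And>k. k < m \<Longrightarrow> 2 * \<kappa> \<le> (1 - \<rho>) * \<bar>\<mu> (Suc k) - \<mu> k\<bar>"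
    and B_pos: "B > 0" and \<mu>_bound: "\<And>k. k \<le> m \<Longrightarrow> \<bar>\<mu> k\<bar> \<le> B"
    and \<rho>_less: "\<bar>\<rho>\<bar> < 1"
    and noise: "centered_noise M \<sigma> \<epsilon>"
    and AR1: "stationary_AR1 M \<rho> \<epsilon> \<eta>"
    and y_0: "\<And>n \<omega>. \<omega> \<in> space M \<Longrightarrow> y n 0 \<omega> = \<mu> 0 + \<eta> 0 \<omega>"
    and y_eq: "\<And>n k i \<omega>. \<omega> \<in> space M \<Longrightarrow> k \<le> m \<Longrightarrow> true_cp \<tau> n k + 1 \<le> i \<Longrightarrow>
           i \<le> true_cp \<tau> n (k + 1) \<Longrightarrow> y n i \<omega> = \<mu> k + \<eta> (int i) \<omega>"
    and \<rho>_bar_meas: "\<And>n. \<rho>_bar n \<in> borel_measurable M"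
    and \<rho>_bar_rate: "big_O_P M (\<lambda>n \<omega>. \<rho>_bar n \<omega> - \<rho>) (\<lambda>n. real n powr (- 1 / 2))"
    and \<Delta>_small: "(\<lambda>n. \<Delta> n / real n) \<longlonglongrightarrow> 0"
    and argmin: "\<And>n \<omega>. segmentations \<Delta> n m \<noteq> {} \<Longrightarrow> \<omega> \<in> space M \<Longrightarrow>
           is_arg_min (\<lambda>(d, t). SS m (\<lambda>i. y n i \<omega>) (\<rho>_bar n \<omega>) d t)
             (\<lambda>(d, t). t \<in> segmentations \<Delta> n m) (\<delta>_hat n \<omega>, t_hat n \<omega>)"
begin

lemma abs_le_two:
  assumes "\<bar>r - \<rho>\<bar> \<le> (1 - \<rho>) / 2" shows "\<bar>r\<bar> \<le> 2"
proof -
  have "\<bar>r\<bar> \<le> \<bar>\<rho>\<bar> + \<bar>r - \<rho>\<bar>" by linarith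
  also have "\<dots> \<le> 1 + (1 - \<rho>) / 2" using assms \<rho>_less by linarith
  also have "\<dots> \<le> 2" using \<rho>_less by (simp add: abs_less_iff)
  finally show ?thesis .
qed

abbreviation s :: "nat \<Rightarrow> nat \<Rightarrow> nat" where "s \<equiv> true_cp \<tau>"

text \<open>
  What holds for all large \<open>n\<close>. The true segments are at least twice as long as the minimal length
  \<open>\<Delta>\<^sub>n\<close>, so that a fitted change can be moved to the true position within the admissible
  segmentations.
\<close>

definition regular :: "nat \<Rightarrow> bool" where
  "regular n \<longleftrightarrow> n > 0 \<and> (\<forall>k\<le>m. \<gamma> * real n \<le> real (s n (Suc k)) - real (s n k)) \<and>
     \<Delta> n \<le> \<gamma> / 2 * real n"

definition z :: "nat \<Rightarrow> 'a \<Rightarrow> nat \<Rightarrow> real" where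
  "z n \<omega> i = y n i \<omega> - \<rho>_bar n \<omega> * y n (i - 1) \<omega>"

definition \<beta> :: "nat \<Rightarrow> 'a \<Rightarrow> nat \<Rightarrow> real" where
  "\<beta> n \<omega> k = (1 - \<rho>_bar n \<omega>) * \<mu> k"

text \<open>
  The jump seen through the quasi-difference: at the first point of a segment, \<open>y\<^sub>i\<^sub>-\<^sub>1\<close> still has the
  previous mean. There is no such term at \<open>i = 1\<close>, because \<open>y\<^sub>0\<close> has the mean of the first segment.
\<close>

definition transient :: "nat \<Rightarrow> 'a \<Rightarrow> nat \<Rightarrow> real" where
  "transient n \<omega> i = (\<Sum>k<m. if i = Suc (s n (Suc k)) then \<rho>_bar n \<omega> * (\<mu> (Suc k) - \<mu> k) else 0)"

definition e :: "nat \<Rightarrow> 'a \<Rightarrow> nat \<Rightarrow> real" where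
  "e n \<omega> i = \<eta> (int i) \<omega> - \<rho>_bar n \<omega> * \<eta> (int i - 1) \<omega> + transient n \<omega> i"

lemma \<tau>_nonneg: "k \<le> Suc m \<Longrightarrow> 0 \<le> \<tau> k"
proof (induction k)
  case (Suc k)
  then show ?case using \<tau>_gap[of k] \<gamma>_pos by simp
qed (simp add: \<tau>_0)

lemma s_0: "s n 0 = 0" and s_end: "s n (Suc m) = n"
  using \<tau>_0 \<tau>_end by (auto simp: true_cp_def)

lemma s_bounds:
  assumes "k \<le> Suc m"
  shows "real (s n k) \<le> real n * \<tau> k" "real n * \<tau> k < real (s n k) + 1"
proof -
  have "0 \<le> real n * \<tau> k" using \<tau>_nonneg[OF assms] by simp
  then show "real (s n k) \<le> real n * \<tau> k" "real n * \<tau> k < real (s n k) + 1"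
    unfolding true_cp_def by linarith+
qed

lemma eventually_regular: "\<forall>\<^sub>F n in sequentially. regular n"
proof -
  have "\<forall>\<^sub>F n in sequentially. \<Delta> n / real n < \<gamma> / 2"
    using \<gamma>_pos by (intro order_tendstoD[OF \<Delta>_small]) auto
  moreover have "\<forall>\<^sub>F n in sequentially. 1 / \<gamma> \<le> real n" by (rule eventually_real_ge)
  ultimately show ?thesis using eventually_gt_at_top[of 0]
  proof eventually_elim
    case (elim n)
    have "1 \<le> \<gamma> * real n" using elim(2) \<gamma>_pos by (simp add: field_simps)
    have "\<gamma> * real n \<le> real (s n (Suc k)) - real (s n k)" if "k \<le> m" for k
    proof -
      have "real n * (2 * \<gamma>) \<le> real n * (\<tau> (Suc k) - \<tau> k)"
        by (intro mult_left_mono \<tau>_gap that) auto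
      then show ?thesis using s_bounds[of k n] s_bounds[of "Suc k" n] that \<open>1 \<le> \<gamma> * real n\<close>
        by (simp add: algebra_simps)
    qed
    moreover have "\<Delta> n \<le> \<gamma> / 2 * real n" using elim by (simp add: field_simps)
    ultimately show ?case using elim by (simp add: regular_def)
  qed
qed

context
  fixes n :: nat and \<omega> :: 'a
  assumes reg: "regular n" and \<omega>: "\<omega> \<in> space M"
begin

lemma n_pos: "n > 0" and gap: "\<And>k. k \<le> m \<Longrightarrow> \<gamma> * real n \<le> real (s n (Suc k)) - real (s n k)"
  and \<Delta>_le: "\<Delta> n \<le> \<gamma> / 2 * real n"
  using reg by (auto simp: regular_def)

lemma s_less: "k \<le> m \<Longrightarrow> s n k < s n (Suc k)"
  using gap[of k] n_pos \<gamma>_pos mult_pos_pos[of \<gamma> "real n"] by linarith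

lemma s_segmentation: "s n \<in> segmentations \<Delta> n m"
proof -
  have "\<Delta> n \<le> real (s n k) - real (s n (k - 1))" if "k \<in> {1..m + 1}" for k
  proof -
    have "0 \<le> \<gamma> * real n" using \<gamma>_pos by simp
    then show ?thesis using gap[of "k - 1"] \<Delta>_le that by (cases k) auto
  qed
  then show ?thesis using s_0 s_end s_less by (auto simp: segmentations_def)
qed

lemma t_hat_segmentation: "t_hat n \<omega> \<in> segmentations \<Delta> n m"
  and t_hat_optimal: "t \<in> segmentations \<Delta> n m \<Longrightarrow>
    residual_ss m (z n \<omega>) (\<delta>_hat n \<omega>) (t_hat n \<omega>) \<le> residual_ss m (z n \<omega>) d t"
proof -
  have ne: "segmentations \<Delta> n m \<noteq> {}" using s_segmentation by auto
  note am = argmin[OF ne \<omega>, unfolded is_arg_min_def]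
  show "t_hat n \<omega> \<in> segmentations \<Delta> n m" using am by simp
  assume t: "t \<in> segmentations \<Delta> n m"
  have "\<not> SS m (\<lambda>i. y n i \<omega>) (\<rho>_bar n \<omega>) d t
      < SS m (\<lambda>i. y n i \<omega>) (\<rho>_bar n \<omega>) (\<delta>_hat n \<omega>) (t_hat n \<omega>)"
    using am t by auto
  then show "residual_ss m (z n \<omega>) (\<delta>_hat n \<omega>) (t_hat n \<omega>) \<le> residual_ss m (z n \<omega>) d t"
    unfolding SS_eq_residual_ss by (simp add: z_def[abs_def])
qed

lemma s_strict_mono: "i < j \<Longrightarrow> j \<le> Suc m \<Longrightarrow> s n i < s n j"
  using segmentation_strict_mono[of m "s n" i j] s_less by blast

lemma z_decomposition:
  assumes k: "k \<le> m" and i: "s n k < i" "i \<le> s n (Suc k)"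
  shows "z n \<omega> i = \<beta> n \<omega> k + e n \<omega> i"
proof -
  have yi: "y n i \<omega> = \<mu> k + \<eta> (int i) \<omega>" using y_eq[OF \<omega> k] i by simp
  have int: "int (i - 1) = int i - 1" using i by simp
  have other: "i \<noteq> Suc (s n (Suc l))" if "l < m" "Suc l \<noteq> k" for l
  proof (cases "Suc l < k")
    case True
    then show ?thesis using s_strict_mono[of "Suc l" k] k i by auto
  next
    case False
    then have "Suc k \<le> Suc l" using that by auto
    then have "s n (Suc k) \<le> s n (Suc l)"
      using s_strict_mono[of "Suc k" "Suc l"] that by (cases "Suc k = Suc l") auto
    then show ?thesis using i by auto
  qed
  show ?thesis
  proof (cases "i = Suc (s n k)")
    case False
    have "y n (i - 1) \<omega> = \<mu> k + \<eta> (int i - 1) \<omega>"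
      using y_eq[OF \<omega> k, of n "i - 1"] i False unfolding int by auto
    moreover have "transient n \<omega> i = 0"
      unfolding transient_def using other False by (intro sum.neutral) force
    ultimately show ?thesis using yi by (simp add: z_def e_def \<beta>_def algebra_simps)
  next
    case True
    show ?thesis
    proof (cases k)
      case 0
      have "y n (i - 1) \<omega> = \<mu> k + \<eta> (int i - 1) \<omega>"
        using y_0[OF \<omega>] True 0 s_0 by simp
      moreover have "transient n \<omega> i = 0"
        unfolding transient_def using other 0 by (intro sum.neutral) force
      ultimately show ?thesis using yi by (simp add: z_def e_def \<beta>_def algebra_simps)
    next
      case (Suc l)
      have "y n (i - 1) \<omega> = \<mu> l + \<eta> (int i - 1) \<omega>"
        using y_eq[OF \<omega>, of l n "i - 1"] s_less[of l] k True Suc unfolding int by auto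
      moreover have "transient n \<omega> i = \<rho>_bar n \<omega> * (\<mu> k - \<mu> l)"
      proof -
        have "transient n \<omega> i = (\<Sum>j<m. if j = l then \<rho>_bar n \<omega> * (\<mu> k - \<mu> l) else 0)"
          unfolding transient_def using other True Suc by (intro sum.cong refl) auto
        then show ?thesis using Suc k by simp
      qed
      ultimately show ?thesis using yi by (simp add: z_def e_def \<beta>_def algebra_simps)
    qed
  qed
qed

lemma sum_transient_le:
  assumes "\<bar>\<rho>_bar n \<omega>\<bar> \<le> 2" "finite A"
  shows "\<bar>\<Sum>i\<in>A. transient n \<omega> i\<bar> \<le> 4 * B * real m"
proof -
  let ?c = "\<lambda>k. \<rho>_bar n \<omega> * (\<mu> (Suc k) - \<mu> k)"
  have c: "\<bar>?c k\<bar> \<le> 4 * B" if "k < m" for k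
  proof -
    have "\<bar>\<mu> (Suc k) - \<mu> k\<bar> \<le> 2 * B" using \<mu>_bound[of k] \<mu>_bound[of "Suc k"] that by auto
    then have "\<bar>\<rho>_bar n \<omega>\<bar> * \<bar>\<mu> (Suc k) - \<mu> k\<bar> \<le> 2 * (2 * B)"
      using assms B_pos by (intro mult_mono) auto
    then show ?thesis by (simp add: abs_mult)
  qed
  have "(\<Sum>i\<in>A. transient n \<omega> i) = (\<Sum>k<m. \<Sum>i\<in>A. if i = Suc (s n (Suc k)) then ?c k else 0)"
    unfolding transient_def by (rule sum.swap)
  also have "\<dots> = (\<Sum>k<m. if Suc (s n (Suc k)) \<in> A then ?c k else 0)"
    using assms(2) by (intro sum.cong refl) (simp add: sum.delta)
  finally have "\<bar>\<Sum>i\<in>A. transient n \<omega> i\<bar> \<le> (\<Sum>k<m. \<bar>if Suc (s n (Suc k)) \<in> A then ?c k else 0\<bar>)"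
    by simp
  also have "\<dots> \<le> (\<Sum>k<m. 4 * B)" using c B_pos by (intro sum_mono) auto
  finally show ?thesis by (simp add: mult.commute)
qed

lemma sum_e_le:
  assumes "\<bar>\<rho>_bar n \<omega>\<bar> \<le> 2" "finite A"
  shows "\<bar>\<Sum>i\<in>A. e n \<omega> i\<bar> \<le> \<bar>\<Sum>i\<in>A. \<eta> (int i) \<omega>\<bar> + 2 * \<bar>\<Sum>i\<in>A. \<eta> (int i - 1) \<omega>\<bar> + 4 * B * real m"
proof -
  have "(\<Sum>i\<in>A. e n \<omega> i) = (\<Sum>i\<in>A. \<eta> (int i) \<omega>) - \<rho>_bar n \<omega> * (\<Sum>i\<in>A. \<eta> (int i - 1) \<omega>)
      + (\<Sum>i\<in>A. transient n \<omega> i)"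
    by (simp add: e_def sum.distrib sum_subtractf sum_distrib_left)
  moreover have "\<bar>\<rho>_bar n \<omega> * (\<Sum>i\<in>A. \<eta> (int i - 1) \<omega>)\<bar> \<le> 2 * \<bar>\<Sum>i\<in>A. \<eta> (int i - 1) \<omega>\<bar>"
    unfolding abs_mult using assms(1) by (intro mult_right_mono) auto
  ultimately show ?thesis using sum_transient_le[OF assms] by linarith
qed

lemma fitted_segmentation: "fitted_segmentation m n (s n) (\<beta> n \<omega>) (e n \<omega>) (z n \<omega>) (t_hat n \<omega>)"
  using t_hat_segmentation s_0 s_end s_less z_decomposition
  by unfold_locales (auto simp: segmentations_def)

text \<open>
  The fixed sample form of the rate for the change-points. The constant in \<open>\<zeta>\<close> is chosen for the
  inequality \<open>4 (m + 1)\<^sup>2 (18 \<zeta>) \<le> \<gamma> \<kappa>\<^sup>2 / 250\<close>, and the factor \<open>18\<close> comes from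
  passing from the windows of \<open>\<eta>\<close> to those of \<open>e\<close>. The values \<open>c = 0, 1\<close> stand for the two sums in
  \<open>e\<^sub>i = \<eta>\<^sub>i - r \<eta>\<^sub>i\<^sub>-\<^sub>1\<close>.
\<close>

lemma change_points_close:
  fixes C :: nat and \<zeta> :: real
  assumes \<rho>_close: "\<bar>\<rho>_bar n \<omega> - \<rho>\<bar> \<le> (1 - \<rho>) / 2"
    and \<zeta>: "\<zeta> = \<gamma> * \<kappa>\<^sup>2 / (18000 * (real m + 1)\<^sup>2)"
    and n_large: "(4 * B * real m)\<^sup>2 \<le> \<zeta> * real n"
    and window: "\<And>c a b. c \<in> {0, 1} \<Longrightarrow> a \<le> b \<Longrightarrow> b \<le> n \<Longrightarrow>
        (\<Sum>i\<in>{a<..b}. \<eta> (int i - c) \<omega>)\<^sup>2 \<le> \<zeta> * real n * real (b - a)"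
    and C: "8 * (4 * B * real m) / \<kappa> < real C"
    and left: "\<And>c k L. c \<in> {0, 1} \<Longrightarrow> k < m \<Longrightarrow> C \<le> L \<Longrightarrow> L \<le> s n (Suc k) \<Longrightarrow>
        \<bar>\<Sum>i\<in>{s n (Suc k) - L<..s n (Suc k)}. \<eta> (int i - c) \<omega>\<bar> \<le> \<kappa> / 24 * real L"
    and right: "\<And>c k L. c \<in> {0, 1} \<Longrightarrow> k < m \<Longrightarrow> C \<le> L \<Longrightarrow>
        \<bar>\<Sum>i\<in>{s n (Suc k)<..s n (Suc k) + L}. \<eta> (int i - c) \<omega>\<bar> \<le> \<kappa> / 24 * real L"
    and k: "k \<le> Suc m"
  shows "\<bar>real (t_hat n \<omega> k) - real (s n k)\<bar> \<le> real C"
proof -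
  interpret fit: fitted_segmentation m n "s n" "\<beta> n \<omega>" "e n \<omega>" "z n \<omega>" "t_hat n \<omega>" "\<delta>_hat n \<omega>"
    by (rule fitted_segmentation)
  let ?R = "4 * B * real m"
  have \<rho>2: "\<bar>\<rho>_bar n \<omega>\<bar> \<le> 2" by (rule abs_le_two[OF \<rho>_close])
  have \<zeta>_pos: "\<zeta> > 0" unfolding \<zeta> using \<gamma>_pos \<kappa>_pos by simp
  have R0: "?R \<ge> 0" using B_pos by simp
  have e_window: "(\<Sum>i\<in>{a<..b}. e n \<omega> i)\<^sup>2 \<le> 18 * \<zeta> * real n * real (b - a)"
    if ab: "a \<le> b" "b \<le> n" for a b
  proof (cases "a = b")
    case False
    define X Y where "X = \<bar>\<Sum>i\<in>{a<..b}. \<eta> (int i) \<omega>\<bar>" and "Y = \<bar>\<Sum>i\<in>{a<..b}. \<eta> (int i - 1) \<omega>\<bar>"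
    define q where "q = \<zeta> * real n * real (b - a)"
    have X: "X\<^sup>2 \<le> q" using window[OF _ ab, of 0] by (simp add: X_def q_def)
    have Y: "Y\<^sup>2 \<le> q" using window[OF _ ab, of 1] by (simp add: Y_def q_def)
    have "\<zeta> * real n * 1 \<le> q" unfolding q_def using \<zeta>_pos False ab by (intro mult_left_mono) auto
    then have R: "?R\<^sup>2 \<le> q" using n_large by linarith
    have "(\<Sum>i\<in>{a<..b}. e n \<omega> i)\<^sup>2 \<le> (X + 2 * Y + ?R)\<^sup>2"
      using sum_e_le[OF \<rho>2, of "{a<..b}"] by (simp add: X_def Y_def abs_le_square_iff[symmetric])
    also have "\<dots> \<le> 3 * X\<^sup>2 + 12 * Y\<^sup>2 + 3 * ?R\<^sup>2"
    proof -
      have "0 \<le> (X - 2 * Y)\<^sup>2 + (X - ?R)\<^sup>2 + (2 * Y - ?R)\<^sup>2" by simp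
      also have "\<dots> = 3 * X\<^sup>2 + 12 * Y\<^sup>2 + 3 * ?R\<^sup>2 - (X + 2 * Y + ?R)\<^sup>2"
        by (simp only: power2_eq_square) algebra
      finally show ?thesis by linarith
    qed
    also have "\<dots> \<le> 18 * q" using X Y R by linarith
    finally show ?thesis by (simp add: q_def)
  qed simp
  have better: "residual_ss m (z n \<omega>) (\<delta>_hat n \<omega>) (t_hat n \<omega>) \<le> residual_ss m (z n \<omega>) (\<beta> n \<omega>) (s n)"
    by (rule t_hat_optimal[OF s_segmentation])
  have err: "(\<Sum>k\<le>m. \<Sum>j\<le>m. real (card (fit.overlap k j)) * (\<delta>_hat n \<omega> j - \<beta> n \<omega> k)\<^sup>2)
      \<le> \<gamma> * \<kappa>\<^sup>2 / 250 * real n"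
  proof -
    have "(real m + 1)\<^sup>2 \<noteq> 0" by simp
    then have eq: "4 * (real m + 1)\<^sup>2 * (18 * \<zeta>) = \<gamma> * \<kappa>\<^sup>2 / 250" unfolding \<zeta> by (simp add: field_simps)
    show ?thesis using fit.fit_error_le[OF better e_window, unfolded eq] \<zeta>_pos by simp
  qed
  have jump: "\<kappa> \<le> \<bar>\<beta> n \<omega> (Suc k) - \<beta> n \<omega> k\<bar>" if "k < m" for k
  proof -
    have "1 - \<rho> \<le> \<bar>1 - \<rho>_bar n \<omega>\<bar> + \<bar>\<rho>_bar n \<omega> - \<rho>\<bar>" by linarith
    then have "(1 - \<rho>) / 2 \<le> \<bar>1 - \<rho>_bar n \<omega>\<bar>" using \<rho>_close by argo
    then have "(1 - \<rho>) / 2 * \<bar>\<mu> (Suc k) - \<mu> k\<bar> \<le> \<bar>1 - \<rho>_bar n \<omega>\<bar> * \<bar>\<mu> (Suc k) - \<mu> k\<bar>"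
      by (intro mult_right_mono) auto
    also have "\<dots> = \<bar>\<beta> n \<omega> (Suc k) - \<beta> n \<omega> k\<bar>"
      by (simp add: \<beta>_def right_diff_distrib[symmetric] abs_mult)
    finally show ?thesis using \<mu>_jump[OF that] by simp
  qed
  note params = \<gamma>_pos \<kappa>_pos n_pos gap jump err
  have small: "\<bar>\<Sum>i\<in>A. e n \<omega> i\<bar> < \<kappa> / 4 * real L"
    if "finite A" "C \<le> L" "\<And>c. c \<in> {0, 1} \<Longrightarrow> \<bar>\<Sum>i\<in>A. \<eta> (int i - c) \<omega>\<bar> \<le> \<kappa> / 24 * real L" for A L
  proof -
    have "8 * ?R < \<kappa> * real C" using C \<kappa>_pos by (simp add: field_simps)
    also have "\<dots> \<le> \<kappa> * real L" using that \<kappa>_pos by simp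
    finally show ?thesis using sum_e_le[OF \<rho>2 that(1)] that(3)[of 0] that(3)[of 1] by simp
  qed
  have admissible: "(t_hat n \<omega>)(Suc k := s n (Suc k)) \<in> segmentations \<Delta> n m" if k: "k < m" for k
  proof -
    have "\<gamma> / 2 * real n > 0" using \<gamma>_pos n_pos by simp
    note close = fit.fitted_changes_consistent[OF params]
    have l: "\<gamma> / 2 * real n \<le> real (s n (Suc k)) - real (t_hat n \<omega> k)"
      using close[of k] gap[of k] k by (simp; linarith)
    have r: "\<gamma> / 2 * real n \<le> real (t_hat n \<omega> (Suc (Suc k))) - real (s n (Suc k))"
      using close[of "Suc (Suc k)"] gap[of "Suc k"] k by (simp; linarith)
    have lr: "t_hat n \<omega> k < s n (Suc k)" "s n (Suc k) < t_hat n \<omega> (Suc (Suc k))"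
      using l r \<open>\<gamma> / 2 * real n > 0\<close> by linarith+
    let ?t = "(t_hat n \<omega>)(Suc k := s n (Suc k))"
    have t1: "?t j < ?t (j + 1)" if "j \<le> m" for j
      using fit.t_less[OF that] lr by auto
    have t2: "\<Delta> n \<le> real (?t j) - real (?t (j - 1))" if j: "j \<in> {1..m + 1}" for j
    proof -
      (* Only the two segments that meet at the moved change have a new length. *)
      consider "j = Suc k" | "j = Suc (Suc k)" | "j \<noteq> Suc k" "j - 1 \<noteq> Suc k" by linarith
      then show ?thesis
      proof cases
        case 3
        then show ?thesis using t_hat_segmentation j by (auto simp: segmentations_def)
      qed (use l r \<Delta>_le in auto)
    qed
    show ?thesis using t1 t2 k t_hat_segmentation by (auto simp: segmentations_def)
  qed
  consider "k = 0" | "k = Suc m" | l where "k = Suc l" "l < m" using k by (cases k) force+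
  then show ?thesis
  proof cases
    case 3
    show ?thesis unfolding 3
    proof (rule fit.fitted_change_rate[OF params 3(2)])
      show "residual_ss m (z n \<omega>) (\<delta>_hat n \<omega>) (t_hat n \<omega>)
          \<le> residual_ss m (z n \<omega>) (\<delta>_hat n \<omega>) ((t_hat n \<omega>)(Suc l := s n (Suc l)))"
        by (rule t_hat_optimal[OF admissible[OF 3(2)]])
    qed (use small left right 3 in auto)
  qed (use s_0 s_end fit.t_0 fit.t_end in auto)
qed

lemma level_error_le:
  fixes C :: nat
  assumes \<rho>2: "\<bar>\<rho>_bar n \<omega>\<bar> \<le> 2"
    and close: "\<And>j. j \<le> Suc m \<Longrightarrow> \<bar>real (t_hat n \<omega> j) - real (s n j)\<bar> \<le> real C"
    and n_large: "4 * real C \<le> \<gamma> * real n"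
    and k: "k \<le> m"
    and sums: "\<And>c. c \<in> {0, 1} \<Longrightarrow> \<bar>\<Sum>i\<in>{t_hat n \<omega> k<..t_hat n \<omega> (Suc k)}. \<eta> (int i - c) \<omega>\<bar> \<le> Q"
  shows "\<bar>\<delta>_hat n \<omega> k - \<beta> n \<omega> k\<bar> * (\<gamma> / 2 * real n) \<le> 6 * Q + 8 * B * real m + 24 * B * real C"
proof -
  interpret fit: fitted_segmentation m n "s n" "\<beta> n \<omega>" "e n \<omega>" "z n \<omega>" "t_hat n \<omega>" "\<delta>_hat n \<omega>"
    by (rule fitted_segmentation)
  have bound: "\<bar>\<beta> n \<omega> j\<bar> \<le> 3 * B" if "j \<le> m" for j
    unfolding \<beta>_def abs_mult using \<rho>2 \<mu>_bound[OF that] B_pos by (intro mult_mono) auto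
  let ?T = "{t_hat n \<omega> k<..t_hat n \<omega> (Suc k)}"
  have "\<gamma> / 2 * real n \<le> real (t_hat n \<omega> (Suc k)) - real (t_hat n \<omega> k)"
    using gap[OF k] close[of k] close[of "Suc k"] k n_large by linarith
  then have "\<bar>\<delta>_hat n \<omega> k - \<beta> n \<omega> k\<bar> * (\<gamma> / 2 * real n)
      \<le> \<bar>\<delta>_hat n \<omega> k - \<beta> n \<omega> k\<bar> * (real (t_hat n \<omega> (Suc k)) - real (t_hat n \<omega> k))"
    by (intro mult_left_mono) auto
  also have "\<dots> \<le> 2 * \<bar>\<Sum>i\<in>?T. e n \<omega> i\<bar> + 8 * (3 * B) * real C"
    by (rule fit.fitted_level_error_le[OF k t_hat_optimal[OF t_hat_segmentation] close bound])
  also have "\<bar>\<Sum>i\<in>?T. e n \<omega> i\<bar> \<le> 3 * Q + 4 * B * real m"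
    using sum_e_le[OF \<rho>2, of ?T] sums[of 0] sums[of 1] by simp
  finally show ?thesis by simp
qed

end

end

section \<open>Stochastic control of the errors\<close>

lemma sum_interval_as_block:
  fixes f :: "int \<Rightarrow> real"
  assumes "a \<le> b"
  shows "(\<Sum>i\<in>{a<..b}. f (int i - c)) = (\<Sum>i<b - a. f (1 - c + int (a + i)))"
  by (rule sum.reindex_bij_witness[of _ "\<lambda>i. Suc (a + i)" "\<lambda>i. i - Suc a"])
     (use assms in \<open>auto simp: algebra_simps of_nat_diff\<close>)

lemma sum_interval_as_reversed_block:
  fixes f :: "int \<Rightarrow> real"
  assumes "L \<le> s"
  shows "(\<Sum>i\<in>{s - L<..s}. f (int i - c)) = (\<Sum>i<L. f (int s - c - int i))"
  by (rule sum.reindex_bij_witness[of _ "\<lambda>i. s - i" "\<lambda>i. s - i"])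
     (use assms in \<open>auto simp: algebra_simps of_nat_diff\<close>)

lemma powr_minus_half: "n > 0 \<Longrightarrow> real n powr - (1 / 2) = 1 / sqrt (real n)"
  using powr_minus_divide[of "real n" "1 / 2"] by (simp add: powr_half_sqrt)

context AR1_change_points
begin

lemma \<eta>_meas [measurable]: "\<eta> i \<in> borel_measurable M"
  using AR1 by (auto simp: stationary_AR1_def stationary_def)

lemma \<eta>_linear_second_moments:
  "\<exists>V>0. \<forall>h. linear_second_moments M V (\<lambda>i. \<eta> (h + int i)) \<and>
    linear_second_moments M V (\<lambda>i. \<eta> (h - int i))"
proof -
  obtain V where V: "V > 0"
    "\<And>h L. integrable M (\<lambda>\<omega>. (\<Sum>j<L. \<eta> (h + int j) \<omega>)\<^sup>2)"
    "\<And>h L. expectation (\<lambda>\<omega>. (\<Sum>j<L. \<eta> (h + int j) \<omega>)\<^sup>2) \<le> V * real L"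
    using AR1_block_sum[OF noise AR1 \<rho>_less] by blast
  have fwd: "(\<Sum>i<L. \<eta> (h + int (a + i)) \<omega>) = (\<Sum>i<L. \<eta> ((h + int a) + int i) \<omega>)" for h a L \<omega>
    by (simp add: algebra_simps)
  have bwd: "(\<Sum>i<L. \<eta> (h - int (a + i)) \<omega>) = (\<Sum>i<L. \<eta> ((h - int a - int L + 1) + int i) \<omega>)" for h a L \<omega>
    by (rule sum.reindex_bij_witness[of _ "\<lambda>i. L - 1 - i" "\<lambda>i. L - 1 - i"])
       (auto simp: algebra_simps of_nat_diff)
  show ?thesis
    unfolding linear_second_moments_def fwd bwd using V by (intro exI[of _ V]) simp
qed

lemma eventually_rare_large_window:
  assumes "p > 0" "\<zeta> > 0"
  shows "\<forall>\<^sub>F n in sequentially. rare M p {\<omega>\<in>space M. \<exists>a b. a \<le> b \<and> b \<le> n \<and>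
    \<zeta> * real n * real (b - a) < (\<Sum>i\<in>{a<..b}. \<eta> (int i - c) \<omega>)\<^sup>2}"
proof -
  obtain V where V: "V > 0" "\<And>h. linear_second_moments M V (\<lambda>i. \<eta> (h + int i))"
    "\<And>h. linear_second_moments M V (\<lambda>i. \<eta> (h - int i))"
    using \<eta>_linear_second_moments by auto
  have "distr M borel (\<eta> i) = distr M borel (\<eta> j)" for i j
    using stationary_distr[of \<eta>] AR1 by (metis stationary_AR1_def)
  then have "\<forall>\<^sub>F n in sequentially. rare M p {\<omega>\<in>space M. \<exists>a L. a + L \<le> n \<and>
      \<zeta> * real n * real L < (\<Sum>i<L. \<eta> (1 - c + int (a + i)) \<omega>)\<^sup>2}"
    by (intro rare_large_window[OF V(2)] assms) auto
  then show ?thesis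
  proof eventually_elim
    case (elim n)
    show ?case
    proof (rule rare_mono[OF elim], rule subsetI)
      fix \<omega> assume "\<omega> \<in> {\<omega>\<in>space M. \<exists>a b. a \<le> b \<and> b \<le> n \<and>
        \<zeta> * real n * real (b - a) < (\<Sum>i\<in>{a<..b}. \<eta> (int i - c) \<omega>)\<^sup>2}"
      then obtain a b where ab: "\<omega> \<in> space M" "a \<le> b" "b \<le> n"
        "\<zeta> * real n * real (b - a) < (\<Sum>i\<in>{a<..b}. \<eta> (int i - c) \<omega>)\<^sup>2" by blast
      then have "a + (b - a) \<le> n"
        "\<zeta> * real n * real (b - a) < (\<Sum>i<b - a. \<eta> (1 - c + int (a + i)) \<omega>)\<^sup>2"
        using sum_interval_as_block[OF ab(2), of "\<lambda>j. \<eta> j \<omega>"] by auto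
      then show "\<omega> \<in> {\<omega>\<in>space M. \<exists>a L. a + L \<le> n \<and>
          \<zeta> * real n * real L < (\<Sum>i<L. \<eta> (1 - c + int (a + i)) \<omega>)\<^sup>2}"
        using ab(1) by blast
    qed simp
  qed
qed

lemma rare_sum_above_line:
  assumes "p > 0" "\<kappa>' > 0"
  shows "\<exists>N::nat. \<forall>(a::nat) c.
    rare M p {\<omega>\<in>space M. \<exists>L\<ge>N. \<kappa>' * real L < \<bar>\<Sum>i\<in>{a<..a + L}. \<eta> (int i - c) \<omega>\<bar>} \<and>
    rare M p {\<omega>\<in>space M. \<exists>L\<ge>N. L \<le> a \<and> \<kappa>' * real L < \<bar>\<Sum>i\<in>{a - L<..a}. \<eta> (int i - c) \<omega>\<bar>}"
proof -
  obtain V where V: "V > 0" "\<And>h. linear_second_moments M V (\<lambda>i. \<eta> (h + int i))"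
    "\<And>h. linear_second_moments M V (\<lambda>i. \<eta> (h - int i))"
    using \<eta>_linear_second_moments by auto
  obtain N where N: "N > 0"
    "\<And>X. linear_second_moments M V X \<Longrightarrow>
      rare M p {\<omega>\<in>space M. \<exists>k\<ge>N. \<kappa>' * real k < \<bar>\<Sum>i<k. X i \<omega>\<bar>}"
    using rare_partial_sum_above_line[OF assms] by blast
  have right: "(\<Sum>i\<in>{a<..a + L}. \<eta> (int i - c) \<omega>) = (\<Sum>i<L. \<eta> ((1 - c + int a) + int i) \<omega>)" for a L c \<omega>
    using sum_interval_as_block[of a "a + L" "\<lambda>j. \<eta> j \<omega>" c] by (simp add: algebra_simps)
  have left: "(\<Sum>i\<in>{a - L<..a}. \<eta> (int i - c) \<omega>) = (\<Sum>i<L. \<eta> ((int a - c) - int i) \<omega>)" if "L \<le> a" for a L c \<omega>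
    using sum_interval_as_reversed_block[OF that, of "\<lambda>j. \<eta> j \<omega>" c] by simp
  show ?thesis
  proof (intro exI[of _ N] allI conjI)
    show "rare M p {\<omega>\<in>space M. \<exists>L\<ge>N. \<kappa>' * real L < \<bar>\<Sum>i\<in>{a<..a + L}. \<eta> (int i - c) \<omega>\<bar>}"
      for a :: nat and c
      unfolding right by (rule N(2)[OF V(2)])
    show "rare M p {\<omega>\<in>space M. \<exists>L\<ge>N. L \<le> a \<and> \<kappa>' * real L < \<bar>\<Sum>i\<in>{a - L<..a}. \<eta> (int i - c) \<omega>\<bar>}"
      for a :: nat and c
      by (rule rare_mono[OF N(2)[OF V(3)[of "int a - c"]]]) (auto simp: left)
  qed
qed

text \<open>
  The fitted segments are random, but within distance \<open>C\<close> of the true ones there are at most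
  \<open>N = (m + 1) (2 C + 1)\<^sup>2\<close> candidates, a number independent of \<open>n\<close>; so a union bound replaces a
  maximal inequality.
\<close>

lemma rare_large_segment_sum:
  fixes C :: nat
  assumes "p > 0"
  obtains K where "K > 0" "\<And>n c. n > 0 \<Longrightarrow> rare M p {\<omega>\<in>space M. \<exists>k\<le>m. \<exists>a b. a \<le> b \<and> b \<le> n \<and>
      \<bar>real a - real (s n k)\<bar> \<le> real C \<and> \<bar>real b - real (s n (Suc k))\<bar> \<le> real C \<and>
      K * sqrt (real n) \<le> \<bar>\<Sum>i\<in>{a<..b}. \<eta> (int i - c) \<omega>\<bar>}"
proof -
  obtain V where V: "V > 0" "\<And>h. linear_second_moments M V (\<lambda>i. \<eta> (h + int i))"
    "\<And>h. linear_second_moments M V (\<lambda>i. \<eta> (h - int i))"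
    using \<eta>_linear_second_moments by auto
  define N where "N = (real m + 1) * (2 * real C + 1)\<^sup>2"
  have N: "N > 0" by (simp add: N_def)
  define K where "K = sqrt (N * V / p)"
  have K: "K > 0" "K\<^sup>2 = N * V / p" using N V(1) assms by (auto simp: K_def)
  show thesis
  proof (rule that[OF K(1)])
    fix n :: nat and c assume n: "n > 0"
    let ?J = "\<lambda>k. {s n k - C..s n k + C}"
    let ?I = "SIGMA k:{..m}. ?J k \<times> ?J (Suc k)"
    let ?A = "\<lambda>(k, a, b). {\<omega>\<in>space M. a \<le> b \<and> b \<le> n \<and> K * sqrt (real n) \<le> \<bar>\<Sum>i\<in>{a<..b}. \<eta> (int i - c) \<omega>\<bar>}"
    have one: "rare M (V / K\<^sup>2) (?A x)" if "x \<in> ?I" for x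
    proof -
      obtain k a b where x: "x = (k, a, b)" by (cases x)
      show ?thesis
      proof (cases "a \<le> b \<and> b \<le> n")
        case False
        then show ?thesis using V(1) by (auto simp: x rare_empty)
      next
        case True
        have "integrable M (\<lambda>\<omega>. (\<Sum>i\<in>{a<..b}. \<eta> (int i - c) \<omega>)\<^sup>2) \<and>
            expectation (\<lambda>\<omega>. (\<Sum>i\<in>{a<..b}. \<eta> (int i - c) \<omega>)\<^sup>2) \<le> V * real (b - a)"
          using V(2)[of "1 - c", unfolded linear_second_moments_def, rule_format, of a "b - a"]
          by (simp only: sum_interval_as_block[OF conjunct1[OF True], of "\<lambda>j. \<eta> j _"])
        moreover have "V * real (b - a) \<le> V * real n" using V(1) True by (intro mult_left_mono) auto
        ultimately have "rare M (V * real n / (K * sqrt (real n))\<^sup>2)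
            {\<omega>\<in>space M. K * sqrt (real n) \<le> \<bar>\<Sum>i\<in>{a<..b}. \<eta> (int i - c) \<omega>\<bar>}"
          using K n by (intro rare_Chebyshev) auto
        moreover have "V * real n / (K * sqrt (real n))\<^sup>2 = V / K\<^sup>2"
          using n by (simp add: power_mult_distrib)
        ultimately show ?thesis using True by (simp add: x)
      qed
    qed
    have cJ: "card (?J k) \<le> 2 * C + 1" for k by auto
    have "card ?I = (\<Sum>k\<le>m. card (?J k) * card (?J (Suc k)))"
      by (subst card_SigmaI) (auto simp: card_cartesian_product)
    also have "\<dots> \<le> (\<Sum>k\<le>m. (2 * C + 1) * (2 * C + 1))"
      by (intro sum_mono mult_le_mono cJ)
    finally have "real (card ?I) \<le> real (\<Sum>k\<le>m. (2 * C + 1) * (2 * C + 1))" by (simp only: of_nat_le_iff)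
    also have "\<dots> = N" by (simp add: N_def power2_eq_square algebra_simps)
    finally have cI: "real (card ?I) \<le> N" .
    have "rare M (\<Sum>x\<in>?I. V / K\<^sup>2) (\<Union>x\<in>?I. ?A x)"
      by (rule rare_UN_finite[OF _ one]) auto
    moreover have "{\<omega>\<in>space M. \<exists>k\<le>m. \<exists>a b. a \<le> b \<and> b \<le> n \<and>
      \<bar>real a - real (s n k)\<bar> \<le> real C \<and> \<bar>real b - real (s n (Suc k))\<bar> \<le> real C \<and>
      K * sqrt (real n) \<le> \<bar>\<Sum>i\<in>{a<..b}. \<eta> (int i - c) \<omega>\<bar>} \<subseteq> (\<Union>x\<in>?I. ?A x)"
    proof
      fix \<omega> assume "\<omega> \<in> {\<omega>\<in>space M. \<exists>k\<le>m. \<exists>a b. a \<le> b \<and> b \<le> n \<and>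
        \<bar>real a - real (s n k)\<bar> \<le> real C \<and> \<bar>real b - real (s n (Suc k))\<bar> \<le> real C \<and>
        K * sqrt (real n) \<le> \<bar>\<Sum>i\<in>{a<..b}. \<eta> (int i - c) \<omega>\<bar>}"
      then obtain k a b where *: "\<omega> \<in> space M" "k \<le> m" "a \<le> b" "b \<le> n"
        "\<bar>real a - real (s n k)\<bar> \<le> real C" "\<bar>real b - real (s n (Suc k))\<bar> \<le> real C"
        "K * sqrt (real n) \<le> \<bar>\<Sum>i\<in>{a<..b}. \<eta> (int i - c) \<omega>\<bar>" by blast
      have "a \<in> ?J k" "b \<in> ?J (Suc k)" using *(5,6) by auto
      then have "(k, a, b) \<in> ?I" using * by auto
      moreover have "\<omega> \<in> ?A (k, a, b)" using * by auto
      ultimately show "\<omega> \<in> (\<Union>x\<in>?I. ?A x)" by blast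
    qed
    moreover have "(\<Sum>x\<in>?I. V / K\<^sup>2) \<le> p"
    proof -
      have "(\<Sum>x\<in>?I. V / K\<^sup>2) = real (card ?I) * (V / K\<^sup>2)" by simp
      also have "\<dots> \<le> N * (V / K\<^sup>2)" using V(1) cI by (intro mult_right_mono) auto
      also have "\<dots> = p" using K(2) N V(1) assms by simp
      finally show ?thesis .
    qed
    ultimately show "rare M p {\<omega>\<in>space M. \<exists>k\<le>m. \<exists>a b. a \<le> b \<and> b \<le> n \<and>
      \<bar>real a - real (s n k)\<bar> \<le> real C \<and> \<bar>real b - real (s n (Suc k))\<bar> \<le> real C \<and>
      K * sqrt (real n) \<le> \<bar>\<Sum>i\<in>{a<..b}. \<eta> (int i - c) \<omega>\<bar>}"
      by (rule rare_mono)
  qed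
qed

lemma eventually_rare_\<rho>_bar_error:
  assumes "p > 0"
  obtains K where "K > 0" "\<forall>\<^sub>F n in sequentially. rare M p {\<omega>\<in>space M. K / sqrt (real n) < \<bar>\<rho>_bar n \<omega> - \<rho>\<bar>}"
    "\<forall>\<^sub>F n in sequentially. K / sqrt (real n) \<le> (1 - \<rho>) / 2"
proof -
  note \<rho>_bar_meas[measurable]
  obtain K where K: "K > 0" "\<forall>\<^sub>F n in sequentially.
      measure M {\<omega>\<in>space M. \<bar>\<rho>_bar n \<omega> - \<rho>\<bar> > K * real n powr (- 1 / 2)} \<le> p"
    using \<rho>_bar_rate assms unfolding big_O_P_def by blast
  have 1: "\<forall>\<^sub>F n in sequentially. rare M p {\<omega>\<in>space M. K / sqrt (real n) < \<bar>\<rho>_bar n \<omega> - \<rho>\<bar>}"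
    using K(2) eventually_gt_at_top[of 0]
  proof eventually_elim
    case (elim n)
    then show ?case unfolding rare_def
      by (intro bexI[of _ "{\<omega>\<in>space M. K / sqrt (real n) < \<bar>\<rho>_bar n \<omega> - \<rho>\<bar>}"]) (auto simp: powr_minus_half)
  qed
  have 2: "\<forall>\<^sub>F n in sequentially. K / sqrt (real n) \<le> (1 - \<rho>) / 2"
  proof -
    have "(\<lambda>n. K / sqrt (real n)) \<longlonglongrightarrow> 0" by real_asymp
    then have "\<forall>\<^sub>F n in sequentially. K / sqrt (real n) < (1 - \<rho>) / 2"
      using \<rho>_less by (intro order_tendstoD) auto
    then show ?thesis by eventually_elim simp
  qed
  show thesis using that K(1) 1 2 .
qed

text \<open>
  The probability \<open>p\<close> is divided into \<open>p / 4\<close> for the preliminary estimate, \<open>p / 8\<close> for each of the two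
  window bounds, and \<open>q\<close> for each of the \<open>4 m\<close> lines that start at a true change, in both
  directions and for both shifts.
\<close>

lemma eventually_rare_change_point_error:
  assumes p: "p > 0"
  obtains C :: nat where "\<forall>\<^sub>F n in sequentially.
     rare M p {\<omega>\<in>space M. \<exists>k\<le>Suc m. real C < \<bar>real (t_hat n \<omega> k) - real (s n k)\<bar>}"
proof -
  define \<zeta> where "\<zeta> = \<gamma> * \<kappa>\<^sup>2 / (18000 * (real m + 1)\<^sup>2)"
  have \<zeta>: "\<zeta> > 0" using \<gamma>_pos \<kappa>_pos by (simp add: \<zeta>_def)
  obtain K where K: "\<forall>\<^sub>F n in sequentially. rare M (p/4) {\<omega>\<in>space M. K / sqrt (real n) < \<bar>\<rho>_bar n \<omega> - \<rho>\<bar>}"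
    "\<forall>\<^sub>F n in sequentially. K / sqrt (real n) \<le> (1 - \<rho>) / 2"
    using eventually_rare_\<rho>_bar_error[of "p/4"] p by auto
  define q where "q = p / (8 * (real m + 1))"
  have q: "q > 0" "4 * real m * q \<le> p / 2" using p by (auto simp: q_def field_simps)
  obtain N where N:
    "\<And>(a::nat) c. rare M q {\<omega>\<in>space M. \<exists>L\<ge>N. \<kappa> / 24 * real L < \<bar>\<Sum>i\<in>{a<..a + L}. \<eta> (int i - c) \<omega>\<bar>}"
    "\<And>(a::nat) c. rare M q {\<omega>\<in>space M. \<exists>L\<ge>N. L \<le> a \<and> \<kappa> / 24 * real L < \<bar>\<Sum>i\<in>{a - L<..a}. \<eta> (int i - c) \<omega>\<bar>}"
    using rare_sum_above_line[OF q(1), of "\<kappa> / 24"] \<kappa>_pos by fastforce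
  obtain C0 :: nat where C0: "8 * (4 * B * real m) / \<kappa> < real C0" using reals_Archimedean2 by blast
  define C where "C = max N C0"
  have C: "8 * (4 * B * real m) / \<kappa> < real C" "N \<le> C" using C0 by (auto simp: C_def)
  let ?W = "\<lambda>n c. {\<omega>\<in>space M. \<exists>a b. a \<le> b \<and> b \<le> n \<and>
    \<zeta> * real n * real (b - a) < (\<Sum>i\<in>{a<..b}. \<eta> (int i - c) \<omega>)\<^sup>2}"
  have W: "\<forall>\<^sub>F n in sequentially. rare M (p/8) (?W n c)" for c
    using p \<zeta> by (intro eventually_rare_large_window) auto
  have n_large: "\<forall>\<^sub>F n in sequentially. (4 * B * real m)\<^sup>2 / \<zeta> \<le> real n" by (rule eventually_real_ge)
  have "\<forall>\<^sub>F n in sequentially.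
     rare M p {\<omega>\<in>space M. \<exists>k\<le>Suc m. real C < \<bar>real (t_hat n \<omega> k) - real (s n k)\<bar>}"
    using eventually_regular K W[of 0] W[of 1] n_large
  proof eventually_elim
    case (elim n)
    let ?\<rho> = "{\<omega>\<in>space M. K / sqrt (real n) < \<bar>\<rho>_bar n \<omega> - \<rho>\<bar>}"
    let ?a = "\<lambda>k. s n (Suc k)"
    let ?Rt = "\<lambda>(k, c). {\<omega>\<in>space M. \<exists>L\<ge>N. \<kappa> / 24 * real L < \<bar>\<Sum>i\<in>{?a k<..?a k + L}. \<eta> (int i - c) \<omega>\<bar>}"
    let ?Lt = "\<lambda>(k, c). {\<omega>\<in>space M. \<exists>L\<ge>N. L \<le> ?a k \<and> \<kappa> / 24 * real L < \<bar>\<Sum>i\<in>{?a k - L<..?a k}. \<eta> (int i - c) \<omega>\<bar>}"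
    let ?I = "{..<m} \<times> {0, 1 :: int}"
    have "rare M (\<Sum>x\<in>?I. q + q) (\<Union>x\<in>?I. ?Rt x \<union> ?Lt x)"
    proof (rule rare_UN_finite)
      show "rare M (q + q) (?Rt x \<union> ?Lt x)" for x
        by (cases x) (simp only: prod.case rare_Un[OF N])
    qed simp
    then have lines: "rare M (p / 2) (\<Union>x\<in>?I. ?Rt x \<union> ?Lt x)"
      by (rule rare_mono) (use q in \<open>auto simp: card_cartesian_product\<close>)
    have "rare M (((p / 4 + p / 8) + p / 8) + p / 2) (((?\<rho> \<union> ?W n 0) \<union> ?W n 1) \<union> (\<Union>x\<in>?I. ?Rt x \<union> ?Lt x))"
      by (intro rare_Un elim lines)
    then show ?case
    proof (rule rare_mono)
      show "{\<omega>\<in>space M. \<exists>k\<le>Suc m. real C < \<bar>real (t_hat n \<omega> k) - real (s n k)\<bar>}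
        \<subseteq> ((?\<rho> \<union> ?W n 0) \<union> ?W n 1) \<union> (\<Union>x\<in>?I. ?Rt x \<union> ?Lt x)"
      proof (rule subsetI, rule ccontr)
        fix \<omega> assume "\<omega> \<in> {\<omega>\<in>space M. \<exists>k\<le>Suc m. real C < \<bar>real (t_hat n \<omega> k) - real (s n k)\<bar>}"
          and good: "\<omega> \<notin> ((?\<rho> \<union> ?W n 0) \<union> ?W n 1) \<union> (\<Union>x\<in>?I. ?Rt x \<union> ?Lt x)"
        then obtain k where \<omega>: "\<omega> \<in> space M" and k: "k \<le> Suc m"
          "real C < \<bar>real (t_hat n \<omega> k) - real (s n k)\<bar>" by blast
        have "\<bar>real (t_hat n \<omega> k) - real (s n k)\<bar> \<le> real C"
        proof (rule change_points_close[OF elim(1) \<omega> _ \<zeta>_def _ _ C(1) _ _ k(1)])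
          have "\<bar>\<rho>_bar n \<omega> - \<rho>\<bar> \<le> K / sqrt (real n)" using good \<omega> by (simp add: not_less)
          then show "\<bar>\<rho>_bar n \<omega> - \<rho>\<bar> \<le> (1 - \<rho>) / 2" using elim(3) by (rule order_trans)
          show "(4 * B * real m)\<^sup>2 \<le> \<zeta> * real n" using elim(6) \<zeta> by (simp add: field_simps)
          show "(\<Sum>i\<in>{a<..b}. \<eta> (int i - c) \<omega>)\<^sup>2 \<le> \<zeta> * real n * real (b - a)"
            if "c \<in> {0, 1}" "a \<le> b" "b \<le> n" for c a b
          proof -
            have "\<omega> \<notin> ?W n c" using good that(1) by auto
            then show ?thesis using \<omega> that by (auto simp: not_less)
          qed
          fix c k L assume ck: "c \<in> {0, 1 :: int}" "k < m" and L: "C \<le> L"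
          have x: "\<omega> \<notin> ?Rt (k, c)" "\<omega> \<notin> ?Lt (k, c)" using good ck by blast+
          have "N \<le> L" using L C(2) by simp
          then show "\<bar>\<Sum>i\<in>{s n (Suc k)<..s n (Suc k) + L}. \<eta> (int i - c) \<omega>\<bar> \<le> \<kappa> / 24 * real L"
            using x(1) \<omega> by (auto simp: not_less)
          show "\<bar>\<Sum>i\<in>{s n (Suc k) - L<..s n (Suc k)}. \<eta> (int i - c) \<omega>\<bar> \<le> \<kappa> / 24 * real L"
            if "L \<le> s n (Suc k)"
            using x(2) \<omega> that \<open>N \<le> L\<close> by (auto simp: not_less)
        qed
        then show False using k(2) by simp
      qed
    qed simp
  qed
  then show thesis by (rule that)
qed

text \<open>
  The error splits into the distance of the fitted level to \<open>(1 - r) \<mu>\<^sub>k\<close>, a sum of errors of order \<open>\<surd>n\<close>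
  over a segment of length of order \<open>n\<close>, and \<open>\<bar>r - \<rho>\<bar> \<bar>\<mu>\<^sub>k\<bar>\<close>, which inherits the rate of the
  preliminary estimate.
\<close>

lemma eventually_rare_level_error:
  assumes p: "p > 0"
  obtains K where "K > 0" "\<forall>\<^sub>F n in sequentially.
     rare M p {\<omega>\<in>space M. \<exists>k\<le>m. K / sqrt (real n) < \<bar>\<delta>_hat n \<omega> k - (1 - \<rho>) * \<mu> k\<bar>}"
proof -
  obtain C where C: "\<forall>\<^sub>F n in sequentially.
     rare M (p/4) {\<omega>\<in>space M. \<exists>k\<le>Suc m. real C < \<bar>real (t_hat n \<omega> k) - real (s n k)\<bar>}"
    using eventually_rare_change_point_error[of "p/4"] p by auto
  obtain K1 where K1: "K1 > 0" "\<forall>\<^sub>F n in sequentially. rare M (p/4) {\<omega>\<in>space M. K1 / sqrt (real n) < \<bar>\<rho>_bar n \<omega> - \<rho>\<bar>}"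
    "\<forall>\<^sub>F n in sequentially. K1 / sqrt (real n) \<le> (1 - \<rho>) / 2"
    using eventually_rare_\<rho>_bar_error[of "p/4"] p by auto
  let ?S = "\<lambda>K n c. {\<omega>\<in>space M. \<exists>k\<le>m. \<exists>a b. a \<le> b \<and> b \<le> n \<and>
      \<bar>real a - real (s n k)\<bar> \<le> real C \<and> \<bar>real b - real (s n (Suc k))\<bar> \<le> real C \<and>
      K * sqrt (real n) \<le> \<bar>\<Sum>i\<in>{a<..b}. \<eta> (int i - c) \<omega>\<bar>}"
  obtain K2 where K2: "K2 > 0" "\<And>n c. n > 0 \<Longrightarrow> rare M (p/4) (?S K2 n c)"
    using rare_large_segment_sum[of "p/4" C] p by auto
  define D where "D = 8 * B * real m + 24 * B * real C"
  define K where "K = 2 / \<gamma> * (6 * K2 + D) + K1 * B"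
  have D: "D \<ge> 0" using B_pos by (simp add: D_def)
  have K: "K > 0" using K1(1) K2(1) B_pos \<gamma>_pos D by (auto simp: K_def intro!: add_nonneg_pos)
  have n_large: "\<forall>\<^sub>F n in sequentially. 4 * real C / \<gamma> \<le> real n" by (rule eventually_real_ge)
  have "\<forall>\<^sub>F n in sequentially.
     rare M p {\<omega>\<in>space M. \<exists>k\<le>m. K / sqrt (real n) < \<bar>\<delta>_hat n \<omega> k - (1 - \<rho>) * \<mu> k\<bar>}"
    using eventually_regular C K1(2,3) n_large
  proof eventually_elim
    case (elim n)
    let ?\<rho> = "{\<omega>\<in>space M. K1 / sqrt (real n) < \<bar>\<rho>_bar n \<omega> - \<rho>\<bar>}"
    let ?T = "{\<omega>\<in>space M. \<exists>k\<le>Suc m. real C < \<bar>real (t_hat n \<omega> k) - real (s n k)\<bar>}"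
    have n: "n > 0" using elim(1) by (simp add: regular_def)
    have "rare M (((p / 4 + p / 4) + p / 4) + p / 4) (((?\<rho> \<union> ?T) \<union> ?S K2 n 0) \<union> ?S K2 n 1)"
      by (intro rare_Un elim K2 n)
    then show ?case
    proof (rule rare_mono)
      show "{\<omega>\<in>space M. \<exists>k\<le>m. K / sqrt (real n) < \<bar>\<delta>_hat n \<omega> k - (1 - \<rho>) * \<mu> k\<bar>}
        \<subseteq> ((?\<rho> \<union> ?T) \<union> ?S K2 n 0) \<union> ?S K2 n 1"
      proof (rule subsetI, rule ccontr)
        fix \<omega> assume "\<omega> \<in> {\<omega>\<in>space M. \<exists>k\<le>m. K / sqrt (real n) < \<bar>\<delta>_hat n \<omega> k - (1 - \<rho>) * \<mu> k\<bar>}"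
          and good: "\<omega> \<notin> ((?\<rho> \<union> ?T) \<union> ?S K2 n 0) \<union> ?S K2 n 1"
        then obtain k where \<omega>: "\<omega> \<in> space M" and k: "k \<le> m"
          "K / sqrt (real n) < \<bar>\<delta>_hat n \<omega> k - (1 - \<rho>) * \<mu> k\<bar>" by blast
        interpret fit: fitted_segmentation m n "s n" "\<beta> n \<omega>" "e n \<omega>" "z n \<omega>" "t_hat n \<omega>" "\<delta>_hat n \<omega>"
          by (rule fitted_segmentation[OF elim(1) \<omega>])
        have close: "\<bar>real (t_hat n \<omega> j) - real (s n j)\<bar> \<le> real C" if "j \<le> Suc m" for j
          using good \<omega> that by (auto simp: not_less)
        have \<rho>': "\<bar>\<rho>_bar n \<omega> - \<rho>\<bar> \<le> K1 / sqrt (real n)" using good \<omega> by auto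
        have \<rho>2: "\<bar>\<rho>_bar n \<omega>\<bar> \<le> 2" by (rule abs_le_two[OF order_trans[OF \<rho>' elim(4)]])
        have sums: "\<bar>\<Sum>i\<in>{t_hat n \<omega> k<..t_hat n \<omega> (Suc k)}. \<eta> (int i - c) \<omega>\<bar> \<le> K2 * sqrt (real n)"
          if c: "c \<in> {0, 1}" for c
        proof -
          have nS: "\<omega> \<notin> ?S K2 n c" using good c by auto
          have le: "t_hat n \<omega> k \<le> t_hat n \<omega> (Suc k)" "t_hat n \<omega> (Suc k) \<le> n"
            using fit.t_less[OF k(1)] fit.t_mono[of "Suc k" "Suc m"] fit.t_end k by auto
          show ?thesis
          proof (rule ccontr)
            assume "\<not> ?thesis"
            then have "K2 * sqrt (real n) \<le> \<bar>\<Sum>i\<in>{t_hat n \<omega> k<..t_hat n \<omega> (Suc k)}. \<eta> (int i - c) \<omega>\<bar>"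
              by simp
            then have "\<omega> \<in> ?S K2 n c"
              unfolding mem_Collect_eq
              by (intro conjI \<omega> exI[of _ k] exI[of _ "t_hat n \<omega> k"] exI[of _ "t_hat n \<omega> (Suc k)"]
                  k(1) le close) (use k in auto)
            then show False using nS by contradiction
          qed
        qed
        have nC: "4 * real C \<le> \<gamma> * real n" using elim(5) \<gamma>_pos by (simp add: field_simps)
        have "\<bar>\<delta>_hat n \<omega> k - \<beta> n \<omega> k\<bar> * (\<gamma> / 2 * real n)
            \<le> 6 * (K2 * sqrt (real n)) + 8 * B * real m + 24 * B * real C"
          by (rule level_error_le[OF elim(1) \<omega> \<rho>2 close nC k(1) sums])
        also have "\<dots> \<le> (6 * K2 + D) * sqrt (real n)"
        proof -
          have "D * 1 \<le> D * sqrt (real n)" using D n by (intro mult_left_mono) auto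
          then show ?thesis by (simp add: D_def algebra_simps)
        qed
        finally have "\<bar>\<delta>_hat n \<omega> k - \<beta> n \<omega> k\<bar> * (\<gamma> / 2 * real n) \<le> (6 * K2 + D) * sqrt (real n)" .
        then have "\<bar>\<delta>_hat n \<omega> k - \<beta> n \<omega> k\<bar> \<le> (6 * K2 + D) * sqrt (real n) / (\<gamma> / 2 * real n)"
          using \<gamma>_pos n by (simp add: pos_le_divide_eq)
        also have "\<dots> = 2 / \<gamma> * (6 * K2 + D) * (sqrt (real n) / real n)" by simp
        also have "sqrt (real n) / real n = 1 / sqrt (real n)"
          using sqrt_divide_self_eq[of "real n"] by (simp add: inverse_eq_divide)
        finally have a: "\<bar>\<delta>_hat n \<omega> k - \<beta> n \<omega> k\<bar> \<le> 2 / \<gamma> * (6 * K2 + D) / sqrt (real n)" by simp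
        have "\<beta> n \<omega> k - (1 - \<rho>) * \<mu> k = - ((\<rho>_bar n \<omega> - \<rho>) * \<mu> k)"
          by (simp add: \<beta>_def algebra_simps)
        then have "\<bar>\<beta> n \<omega> k - (1 - \<rho>) * \<mu> k\<bar> = \<bar>\<rho>_bar n \<omega> - \<rho>\<bar> * \<bar>\<mu> k\<bar>"
          by (simp only: abs_minus abs_mult)
        also have "\<dots> \<le> K1 / sqrt (real n) * B"
          using \<rho>' \<mu>_bound[OF k(1)] K1(1) by (intro mult_mono) auto
        finally have b: "\<bar>\<beta> n \<omega> k - (1 - \<rho>) * \<mu> k\<bar> \<le> K1 * B / sqrt (real n)" by simp
        have "\<bar>\<delta>_hat n \<omega> k - (1 - \<rho>) * \<mu> k\<bar> \<le> K / sqrt (real n)"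
          using a b unfolding K_def add_divide_distrib by linarith
        then show False using k(2) by simp
      qed
    qed simp
  qed
  with K show thesis by (rule that)
qed

text \<open>
  Rounding \<open>n \<tau>\<^sub>k\<close> to an integer costs at most one more unit.
\<close>

lemma change_fractions_rate:
  "big_O_P M (\<lambda>n \<omega>. L2_set (\<lambda>k. real (t_hat n \<omega> k) / real n - \<tau> k) {0..m + 1}) (\<lambda>n. 1 / real n)"
  unfolding big_O_P_def
proof (intro allI impI)
  fix p :: real assume "p > 0"
  then obtain C where C: "\<forall>\<^sub>F n in sequentially.
     rare M p {\<omega>\<in>space M. \<exists>k\<le>Suc m. real C < \<bar>real (t_hat n \<omega> k) - real (s n k)\<bar>}"
    using eventually_rare_change_point_error by blast
  let ?C = "(real m + 2) * (real C + 1)"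
  have "\<forall>\<^sub>F n in sequentially. measure M {\<omega>\<in>space M.
      \<bar>L2_set (\<lambda>k. real (t_hat n \<omega> k) / real n - \<tau> k) {0..m + 1}\<bar> > ?C * (1 / real n)} \<le> p"
    using C eventually_gt_at_top[of 0]
  proof eventually_elim
    case (elim n)
    have "{\<omega>\<in>space M. \<bar>L2_set (\<lambda>k. real (t_hat n \<omega> k) / real n - \<tau> k) {0..m + 1}\<bar> > ?C * (1 / real n)}
      \<subseteq> {\<omega>\<in>space M. \<exists>k\<le>Suc m. real C < \<bar>real (t_hat n \<omega> k) - real (s n k)\<bar>}"
    proof (rule subsetI, rule ccontr)
      fix \<omega> assume "\<omega> \<in> {\<omega>\<in>space M. \<bar>L2_set (\<lambda>k. real (t_hat n \<omega> k) / real n - \<tau> k) {0..m + 1}\<bar> > ?C * (1 / real n)}"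
        and "\<omega> \<notin> {\<omega>\<in>space M. \<exists>k\<le>Suc m. real C < \<bar>real (t_hat n \<omega> k) - real (s n k)\<bar>}"
      then have large: "?C * (1 / real n) < \<bar>L2_set (\<lambda>k. real (t_hat n \<omega> k) / real n - \<tau> k) {0..m + 1}\<bar>"
        and close: "\<And>k. k \<le> Suc m \<Longrightarrow> \<bar>real (t_hat n \<omega> k) - real (s n k)\<bar> \<le> real C"
        by (auto simp: not_less)
      have "\<bar>real (t_hat n \<omega> k) / real n - \<tau> k\<bar> \<le> (real C + 1) / real n" if k: "k \<in> {0..m + 1}" for k
      proof -
        have "\<bar>real (t_hat n \<omega> k) - real n * \<tau> k\<bar> \<le> real C + 1"
          using close[of k] s_bounds[of k n] k by auto
        moreover have "real (t_hat n \<omega> k) / real n - \<tau> k = (real (t_hat n \<omega> k) - real n * \<tau> k) / real n"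
          using elim by (simp add: field_simps)
        ultimately show ?thesis using elim by (simp add: abs_divide divide_right_mono)
      qed
      then have "(\<Sum>k\<in>{0..m + 1}. \<bar>real (t_hat n \<omega> k) / real n - \<tau> k\<bar>) \<le> (\<Sum>k\<in>{0..m + 1}. (real C + 1) / real n)"
        by (rule sum_mono)
      also have "\<dots> = ?C * (1 / real n)" by simp
      finally show False
        using large L2_set_le_sum_abs[of "\<lambda>k. real (t_hat n \<omega> k) / real n - \<tau> k" "{0..m + 1}"]
          L2_set_nonneg[of "\<lambda>k. real (t_hat n \<omega> k) / real n - \<tau> k" "{0..m + 1}"] by linarith
    qed
    then show ?case by (intro measure_le_of_rare rare_mono[OF elim(1)]) auto
  qed
  then show "\<exists>C>0. \<forall>\<^sub>F n in sequentially. measure M {\<omega>\<in>space M.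
      \<bar>L2_set (\<lambda>k. real (t_hat n \<omega> k) / real n - \<tau> k) {0..m + 1}\<bar> > C * (1 / real n)} \<le> p"
    by (intro exI[of _ ?C]) auto
qed

lemma levels_rate:
  "big_O_P M (\<lambda>n \<omega>. L2_set (\<lambda>k. \<delta>_hat n \<omega> k - (1 - \<rho>) * \<mu> k) {0..m}) (\<lambda>n. real n powr (- 1 / 2))"
  unfolding big_O_P_def
proof (intro allI impI)
  fix p :: real assume "p > 0"
  then obtain K where K: "K > 0" "\<forall>\<^sub>F n in sequentially.
     rare M p {\<omega>\<in>space M. \<exists>k\<le>m. K / sqrt (real n) < \<bar>\<delta>_hat n \<omega> k - (1 - \<rho>) * \<mu> k\<bar>}"
    using eventually_rare_level_error by blast
  let ?C = "(real m + 1) * K"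
  have "\<forall>\<^sub>F n in sequentially. measure M {\<omega>\<in>space M.
      \<bar>L2_set (\<lambda>k. \<delta>_hat n \<omega> k - (1 - \<rho>) * \<mu> k) {0..m}\<bar> > ?C * real n powr (- 1 / 2)} \<le> p"
    using K(2) eventually_gt_at_top[of 0]
  proof eventually_elim
    case (elim n)
    have "{\<omega>\<in>space M. \<bar>L2_set (\<lambda>k. \<delta>_hat n \<omega> k - (1 - \<rho>) * \<mu> k) {0..m}\<bar> > ?C * real n powr (- 1 / 2)}
      \<subseteq> {\<omega>\<in>space M. \<exists>k\<le>m. K / sqrt (real n) < \<bar>\<delta>_hat n \<omega> k - (1 - \<rho>) * \<mu> k\<bar>}"
    proof (rule subsetI, rule ccontr)
      fix \<omega> assume "\<omega> \<in> {\<omega>\<in>space M. \<bar>L2_set (\<lambda>k. \<delta>_hat n \<omega> k - (1 - \<rho>) * \<mu> k) {0..m}\<bar> > ?C * real n powr (- 1 / 2)}"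
        and "\<omega> \<notin> {\<omega>\<in>space M. \<exists>k\<le>m. K / sqrt (real n) < \<bar>\<delta>_hat n \<omega> k - (1 - \<rho>) * \<mu> k\<bar>}"
      then have large: "?C * real n powr (- 1 / 2) < \<bar>L2_set (\<lambda>k. \<delta>_hat n \<omega> k - (1 - \<rho>) * \<mu> k) {0..m}\<bar>"
        and close: "\<And>k. k \<le> m \<Longrightarrow> \<bar>\<delta>_hat n \<omega> k - (1 - \<rho>) * \<mu> k\<bar> \<le> K / sqrt (real n)"
        by (auto simp: not_less)
      have "(\<Sum>k\<in>{0..m}. \<bar>\<delta>_hat n \<omega> k - (1 - \<rho>) * \<mu> k\<bar>) \<le> (\<Sum>k\<in>{0..m}. K / sqrt (real n))"
        by (intro sum_mono close) auto
      also have "\<dots> = ?C * real n powr (- 1 / 2)" using elim by (simp add: powr_minus_half)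
      finally show False
        using large L2_set_le_sum_abs[of "\<lambda>k. \<delta>_hat n \<omega> k - (1 - \<rho>) * \<mu> k" "{0..m}"]
          L2_set_nonneg[of "\<lambda>k. \<delta>_hat n \<omega> k - (1 - \<rho>) * \<mu> k" "{0..m}"] by linarith
    qed
    then show ?case by (intro measure_le_of_rare rare_mono[OF elim(1)]) auto
  qed
  then show "\<exists>C>0. \<forall>\<^sub>F n in sequentially. measure M {\<omega>\<in>space M.
      \<bar>L2_set (\<lambda>k. \<delta>_hat n \<omega> k - (1 - \<rho>) * \<mu> k) {0..m}\<bar> > C * real n powr (- 1 / 2)} \<le> p"
    using K(1) by (intro exI[of _ ?C]) auto
qed

end

theorem proposition3:
  fixes M :: "'a measure" and m :: nat
    and \<tau> \<mu> \<delta> :: "nat \<Rightarrow> real" and \<rho> \<sigma> \<alpha> :: real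
    and \<epsilon> \<eta> :: "int \<Rightarrow> 'a \<Rightarrow> real"
    and y :: "nat \<Rightarrow> nat \<Rightarrow> 'a \<Rightarrow> real"
    and \<rho>_bar :: "nat \<Rightarrow> 'a \<Rightarrow> real" and \<Delta> :: "nat \<Rightarrow> real"
    and \<delta>_hat :: "nat \<Rightarrow> 'a \<Rightarrow> nat \<Rightarrow> real" and t_hat :: "nat \<Rightarrow> 'a \<Rightarrow> nat \<Rightarrow> nat"
    and \<tau>_hat :: "nat \<Rightarrow> 'a \<Rightarrow> nat \<Rightarrow> real"
  assumes "prob_space M"
    and "\<tau> 0 = 0" and "\<tau> (m + 1) = 1" and "\<And>k. k \<le> m \<Longrightarrow> \<tau> k < \<tau> (k + 1)"
    and "\<And>k. 1 \<le> k \<Longrightarrow> k \<le> m \<Longrightarrow> \<mu> k \<noteq> \<mu> (k - 1)"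
    and "\<bar>\<rho>\<bar> < 1" and "\<sigma> > 0"
    and "\<And>k. k \<le> m \<Longrightarrow> \<delta> k = (1 - \<rho>) * \<mu> k"
    and "gaussian_noise M \<sigma> \<epsilon> \<or> centered_noise M \<sigma> \<epsilon>"
    and "stationary_AR1 M \<rho> \<epsilon> \<eta>"
    and "\<And>n \<omega>. \<omega> \<in> space M \<Longrightarrow> y n 0 \<omega> = \<mu> 0 + \<eta> 0 \<omega>"
    and "\<And>n k i \<omega>. \<omega> \<in> space M \<Longrightarrow> k \<le> m \<Longrightarrow> true_cp \<tau> n k + 1 \<le> i \<Longrightarrow>
           i \<le> true_cp \<tau> n (k + 1) \<Longrightarrow> y n i \<omega> = \<mu> k + \<eta> (int i) \<omega>"
    and "\<And>n. \<rho>_bar n \<in> borel_measurable M"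
    and "big_O_P M (\<lambda>n \<omega>. \<rho>_bar n \<omega> - \<rho>) (\<lambda>n. real n powr (- 1 / 2))"
    and "(\<lambda>n. \<Delta> n / real n) \<longlonglongrightarrow> 0"
    and "\<alpha> > 0" and "filterlim (\<lambda>n. real n powr (- \<alpha>) * \<Delta> n) at_top sequentially"
    and "\<And>n k. segmentations \<Delta> n m \<noteq> {} \<Longrightarrow> k \<le> m \<Longrightarrow>
           (\<lambda>\<omega>. \<delta>_hat n \<omega> k) \<in> borel_measurable M"
    and "\<And>n k. segmentations \<Delta> n m \<noteq> {} \<Longrightarrow> k \<le> m + 1 \<Longrightarrow>
           (\<lambda>\<omega>. t_hat n \<omega> k) \<in> measurable M (count_space UNIV)"
    and "\<And>n \<omega>. segmentations \<Delta> n m \<noteq> {} \<Longrightarrow> \<omega> \<in> space M \<Longrightarrow>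
           is_arg_min (\<lambda>(d, t). SS m (\<lambda>i. y n i \<omega>) (\<rho>_bar n \<omega>) d t)
             (\<lambda>(d, t). t \<in> segmentations \<Delta> n m) (\<delta>_hat n \<omega>, t_hat n \<omega>)"
    and "\<And>n \<omega> k. \<tau>_hat n \<omega> k = real (t_hat n \<omega> k) / real n"
  shows "big_O_P M (\<lambda>n \<omega>. L2_set (\<lambda>k. \<tau>_hat n \<omega> k - \<tau> k) {0..m + 1}) (\<lambda>n. 1 / real n) \<and>
         big_O_P M (\<lambda>n \<omega>. L2_set (\<lambda>k. \<delta>_hat n \<omega> k - \<delta> k) {0..m}) (\<lambda>n. real n powr (- 1 / 2))"
proof -
  interpret prob_space M by (rule assms(1))
  obtain g where g: "g > 0" "\<And>k. k \<in> {..m} \<Longrightarrow> g \<le> \<tau> (Suc k) - \<tau> k"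
    by (rule finite_positive_lower_bound[of "{..m}" "\<lambda>k. \<tau> (Suc k) - \<tau> k"]) (use assms(4) in auto)
  obtain c where c: "c > 0" "\<And>k. k \<in> {..<m} \<Longrightarrow> c \<le> (1 - \<rho>) * \<bar>\<mu> (Suc k) - \<mu> k\<bar>"
  proof (rule finite_positive_lower_bound[of "{..<m}" "\<lambda>k. (1 - \<rho>) * \<bar>\<mu> (Suc k) - \<mu> k\<bar>"])
    show "0 < (1 - \<rho>) * \<bar>\<mu> (Suc k) - \<mu> k\<bar>" if "k \<in> {..<m}" for k
      using assms(5)[of "Suc k"] assms(6) that by auto
  qed auto
  obtain B where B: "B > 0" "\<And>k. k \<in> {..m} \<Longrightarrow> \<bar>\<mu> k\<bar> \<le> B"
    by (rule finite_upper_bound[of "{..m}" \<mu>]) auto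
  have centered: "centered_noise M \<sigma> \<epsilon>"
    using assms(7,9) gaussian_imp_centered_noise by blast
  interpret AR1_change_points M m \<tau> \<mu> \<rho> \<sigma> \<epsilon> \<eta> y \<rho>_bar \<Delta> \<delta>_hat t_hat "g / 2" "c / 2" B
  proof unfold_locales
    show "2 * (g / 2) \<le> \<tau> (Suc k) - \<tau> k" if "k \<le> m" for k using g(2)[of k] that by simp
    show "2 * (c / 2) \<le> (1 - \<rho>) * \<bar>\<mu> (Suc k) - \<mu> k\<bar>" if "k < m" for k using c(2)[of k] that by simp
    show "\<bar>\<mu> k\<bar> \<le> B" if "k \<le> m" for k using B(2)[of k] that by simp
    show "0 < g / 2" "0 < c / 2" using g(1) c(1) by simp_all
  qed (fact assms B(1) centered)+
  have "(\<lambda>n \<omega>. L2_set (\<lambda>k. \<delta>_hat n \<omega> k - \<delta> k) {0..m})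
      = (\<lambda>n \<omega>. L2_set (\<lambda>k. \<delta>_hat n \<omega> k - (1 - \<rho>) * \<mu> k) {0..m})"
    by (intro ext L2_set_cong) (use assms(8) in auto)
  then show ?thesis
    using change_fractions_rate levels_rate by (simp only: assms(21) simp_thms)
qed

end
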